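(* Let $Y$ be a discrete target variable with values in a finite set $\mathcal Y$ and $p(y_k)=P(Y=y_k)$, and let $\mathbf X=(X_1,\dots,X_d)$ be continuous explanatory variables (features), possibly with marginals from different families, such that the dependence between the features is described by a Gaussian copula. Let $(V,\mathcal C,\mathcal S,\mathcal M)$ be a GNB junction tree on $V=\{0,1,\dots,d\}$. Then the weight of the GNB approximation is $$W_{GNB}^{c_G}=\sum_{i=1}^{d}H(X_i)-\sum_{y_k\in\mathcal Y}p(y_k)\sum_{i=1}^{d}H(X_i\mid y_k)-\sum_{(i,j,0)\in\mathcal C}\ \sum_{y_k\in\mathcal Y}p(y_k)\log\Big(1-\big(\rho^{c_G}_{z_i,z_j\mid k}\big)^2\Big),$$ where $\rho^{c_G}_{z_i,z_j\mid k}$ is the correlation coefficient of the bivariate Gauss copula corresponding to the transformed data $z_i$ and $z_j$ after filtering for the given class $y_k$.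
   Context: $\log$ is the natural logarithm, $\Phi$ is the standard normal c.d.f. Transformed data: for a class $y_k$, the values $x_i$ of $X_i$ in that class are transformed to $u_{i\mid k}=\widehat F_i(x_i\mid y_k)\in(0,1)$, where $\widehat F_i(\cdot\mid y_k)$ is the (kernel-estimated) c.d.f. of $X_i$ given $Y=y_k$, and then to $z_{i\mid k}=\Phi^{-1}(u_{i\mid k})$, which has a standard normal distribution; $\rho^{c_G}_{z_i,z_j\mid k}$ is the correlation between the resulting variables $Z_{i\mid k}$ and $Z_{j\mid k}$ under the Gaussian copula assumption. GNB structure: on $V=\{0\}\cup D$, $D=\{1,\dots,d\}$ (vertex $0$ stands for $Y$), a GNB graph is built as follows. Start with a triangle $\{0,i_1,i_2\}$, $i_1,i_2\in D$ distinct. Then repeatedly add a new vertex $i_{k+1}\in D$, connecting it to $0$ and to one already present vertex of $\{i_1,\dots,i_k\}$, until all of $D$ is used. GNB junction tree: the set of clusters $\mathcal C$ consists of the 3-element maximal cliques $(i,j,0)$; the set of separators $\mathcal S$ consists of the pairs $S=(s,0)$ that are intersections of connected clusters (two clusters are connected only if they share 2 elements, and the clusters containing a common pair are connected tree-like); $\mathcal M$ records the multiplicities, where the multiplicity $\nu_S$ is the number of clusters containing $S$. Entropies: $H$ denotes (differential) entropy, $H(\cdot\mid y_k)$ the entropy of the conditional law given $Y=y_k$; for a mixed vector $H(\mathbf X_A,Y)=-\sum_y\int p(\mathbf x_A,y)\log p(\mathbf x_A,y)\,d\mathbf x_A$, with $p(\mathbf x_A,y)$ the joint density/mass function. Information content: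 $I(X_i,X_j,Y)=H(X_i)+H(X_j)+H(Y)-H(X_i,X_j,Y)$ and $I(X_s,Y)=H(X_s)+H(Y)-H(X_s,Y)$. Weight: $W_{GNB}^{c_G}=\sum_{(i,j,0)\in\mathcal C}I(X_i,X_j,Y)-\sum_{S=(s,0)\in\mathcal S}(\nu_S-1)I(X_s,Y)$.
   Formalization: The last term carries a factor 1/2 missing in the printed formula, which fails for d=2, one class and a bivariate normal with correlation ρ≠0; the class entropies H(X_i|y_k) are assumed finite and the Gaussian copula of each class nondegenerate (positive definite correlation matrix). *)

theory Defs
  imports "HOL-Probability.Probability"
begin

section \<open>GNB graphs and GNB junction trees\<close>

text \<open>
  The features are indexed by a finite linearly ordered type \<^typ>\<open>'n\<close>, playing the role of
  \<open>{1..d}\<close>. Vertices have type \<^typ>\<open>'n option\<close>: \<^term>\<open>None\<close> is the vertex \<open>0\<close> of the target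
  variable and \<^term>\<open>Some i\<close> is the vertex of feature \<open>i\<close>. Edges are two-element vertex sets.
\<close>

inductive gnb_graph :: "'n option set \<Rightarrow> 'n option set set \<Rightarrow> bool" where
  triangle: "i \<noteq> j \<Longrightarrow>
    gnb_graph {None, Some i, Some j} {{None, Some i}, {None, Some j}, {Some i, Some j}}"
| extend: "gnb_graph V E \<Longrightarrow> Some j \<in> V \<Longrightarrow> Some k \<notin> V \<Longrightarrow>
    gnb_graph (insert (Some k) V) (E \<union> {{None, Some k}, {Some j, Some k}})"

definition is_clique :: "'v set \<Rightarrow> 'v set set \<Rightarrow> 'v set \<Rightarrow> bool" where
  "is_clique V E K \<longleftrightarrow> K \<subseteq> V \<and> (\<forall>a\<in>K. \<forall>b\<in>K. a \<noteq> b \<longrightarrow> {a, b} \<in> E)"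

definition is_maximal_clique :: "'v set \<Rightarrow> 'v set set \<Rightarrow> 'v set \<Rightarrow> bool" where
  "is_maximal_clique V E K \<longleftrightarrow> is_clique V E K \<and> (\<forall>L. is_clique V E L \<longrightarrow> K \<subseteq> L \<longrightarrow> L = K)"

definition is_cycle :: "'v set set \<Rightarrow> 'v list \<Rightarrow> bool" where
  "is_cycle E p \<longleftrightarrow> 3 \<le> length p \<and> distinct p \<and>
     (\<forall>k. Suc k < length p \<longrightarrow> {p ! k, p ! Suc k} \<in> E) \<and> {last p, hd p} \<in> E"

definition is_tree :: "'v set \<Rightarrow> 'v set set \<Rightarrow> bool" where
  "is_tree N E \<longleftrightarrow>
     (\<forall>e\<in>E. e \<subseteq> N \<and> card e = 2) \<and>
     (\<forall>a\<in>N. \<forall>b\<in>N. (a, b) \<in> {(u, v). {u, v} \<in> E}\<^sup>*) \<and>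
     (\<nexists>p. is_cycle E p)"

text \<open>
  \<open>T\<close> is the set of connections of clusters. The condition on \<open>P\<close> says that the clusters containing
  a common pair of vertices are connected tree-like.
\<close>

definition gnb_junction_tree ::
  "'n option set \<Rightarrow> 'n option set set \<Rightarrow> 'n option set set \<Rightarrow> ('n option set \<Rightarrow> nat) \<Rightarrow> bool"
where
  "gnb_junction_tree V C S \<nu> \<longleftrightarrow> (\<exists>E T.
     gnb_graph V E \<and>
     C = {K. is_maximal_clique V E K \<and> card K = 3} \<and>
     is_tree C T \<and>
     (\<forall>K L. {K, L} \<in> T \<longrightarrow> card (K \<inter> L) = 2) \<and>
     (\<forall>P. card P = 2 \<longrightarrow>
        is_tree {K \<in> C. P \<subseteq> K} {e \<in> T. e \<subseteq> {K \<in> C. P \<subseteq> K}}) \<and>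
     S = {K \<inter> L | K L. {K, L} \<in> T} \<and>
     (\<forall>s\<in>S. \<nu> s = card {K \<in> C. s \<subseteq> K}))"

text \<open>Each cluster \<open>(i, j, 0)\<close> is listed once, with \<open>i < j\<close>.\<close>

definition cluster_pairs :: "'n::linorder option set set \<Rightarrow> ('n \<times> 'n) set" where
  "cluster_pairs C = {(i, j). i < j \<and> {None, Some i, Some j} \<in> C}"

definition separator_features :: "'n option set set \<Rightarrow> 'n set" where
  "separator_features S = {s. {None, Some s} \<in> S}"


section \<open>Gaussian copulas\<close>

definition std_normal_cdf :: "real \<Rightarrow> real" where
  "std_normal_cdf = cdf std_normal_distribution"

text \<open>Positive definiteness is what makes the Gaussian copula have a density.\<close>

definition correlation_matrix :: "real^'n^'n \<Rightarrow> bool" where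
  "correlation_matrix R \<longleftrightarrow>
     transpose R = R \<and> (\<forall>i. R $ i $ i = 1) \<and> (\<forall>v. v \<noteq> 0 \<longrightarrow> v \<bullet> (R *v v) > 0)"

definition multivariate_normal :: "real^'n^'n \<Rightarrow> (real^'n) measure" where
  "multivariate_normal R = density lborel (\<lambda>z. ennreal
     (exp (- (z \<bullet> (matrix_inv R *v z)) / 2) / sqrt ((2 * pi) ^ CARD('n) * det R)))"

text \<open>Used only on the open unit cube, where \<^term>\<open>inv std_normal_cdf\<close> is the true inverse.\<close>

definition gauss_copula :: "real^'n^'n \<Rightarrow> ('n \<Rightarrow> real) \<Rightarrow> real" where
  "gauss_copula R u =
     measure (multivariate_normal R) {z. \<forall>i. z $ i \<le> inv std_normal_cdf (u i)}"

text \<open>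
  Sklar's relation between the joint and the marginal distribution functions. For continuous
  marginals its values where some marginal is \<open>0\<close> or \<open>1\<close> are determined by the remaining ones.
\<close>

definition has_gauss_copula ::
  "'a measure \<Rightarrow> ('n::finite \<Rightarrow> 'a \<Rightarrow> real) \<Rightarrow> real^'n^'n \<Rightarrow> bool" where
  "has_gauss_copula P X R \<longleftrightarrow>
     (\<forall>x. (\<forall>i. 0 < cdf (distr P borel (X i)) (x i) \<and> cdf (distr P borel (X i)) (x i) < 1) \<longrightarrow>
        measure P {\<omega> \<in> space P. \<forall>i. X i \<omega> \<le> x i} =
        gauss_copula R (\<lambda>i. cdf (distr P borel (X i)) (x i)))"

definition correlation :: "'a measure \<Rightarrow> ('a \<Rightarrow> real) \<Rightarrow> ('a \<Rightarrow> real) \<Rightarrow> real" where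
  "correlation P U W =
     (\<integral>\<omega>. (U \<omega> - integral\<^sup>L P U) * (W \<omega> - integral\<^sup>L P W) \<partial>P) /
     sqrt ((\<integral>\<omega>. (U \<omega> - integral\<^sup>L P U)\<^sup>2 \<partial>P) * (\<integral>\<omega>. (W \<omega> - integral\<^sup>L P W)\<^sup>2 \<partial>P))"


section \<open>Conditioning on a class\<close>

definition class_prob :: "'a measure \<Rightarrow> ('a \<Rightarrow> 'y) \<Rightarrow> 'y \<Rightarrow> real" where
  "class_prob M Y y = measure M (Y -` {y} \<inter> space M)"

definition given_class :: "'a measure \<Rightarrow> ('a \<Rightarrow> 'y) \<Rightarrow> 'y \<Rightarrow> 'a measure" where
  "given_class M Y y = uniform_measure M (Y -` {y} \<inter> space M)"

definition transformed ::
  "'a measure \<Rightarrow> ('n \<Rightarrow> 'a \<Rightarrow> real) \<Rightarrow> ('a \<Rightarrow> 'y) \<Rightarrow> 'y \<Rightarrow> 'n \<Rightarrow> 'a \<Rightarrow> real" where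
  "transformed M X Y y i \<omega> =
     inv std_normal_cdf (cdf (distr (given_class M Y y) borel (X i)) (X i \<omega>))"

definition class_corr ::
  "'a measure \<Rightarrow> ('n \<Rightarrow> 'a \<Rightarrow> real) \<Rightarrow> ('a \<Rightarrow> 'y) \<Rightarrow> 'y \<Rightarrow> 'n \<Rightarrow> 'n \<Rightarrow> real" where
  "class_corr M X Y y i j =
     correlation (given_class M Y y) (transformed M X Y y i) (transformed M X Y y j)"


section \<open>Entropy, information content and weight\<close>

text \<open>
  Entropy in nats relative to the reference measure \<open>S\<close>. For mixed vectors the reference measure is
  the product of Lebesgue measure and counting measure on the set of classes; for \<open>Y\<close> alone it is the
  counting measure.
\<close>

abbreviation diff_entropy :: "'a measure \<Rightarrow> 'b measure \<Rightarrow> ('a \<Rightarrow> 'b) \<Rightarrow> real" where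
  "diff_entropy P S Z \<equiv> prob_space.entropy P (exp 1) S Z"

definition info_pair_class ::
  "'a measure \<Rightarrow> ('n \<Rightarrow> 'a \<Rightarrow> real) \<Rightarrow> ('a \<Rightarrow> 'y) \<Rightarrow> 'y set \<Rightarrow> 'n \<Rightarrow> 'n \<Rightarrow> real" where
  "info_pair_class M X Y Ys i j =
     diff_entropy M lborel (X i) + diff_entropy M lborel (X j) + diff_entropy M (count_space Ys) Y
     - diff_entropy M (lborel \<Otimes>\<^sub>M lborel \<Otimes>\<^sub>M count_space Ys) (\<lambda>\<omega>. (X i \<omega>, X j \<omega>, Y \<omega>))"

definition info_class ::
  "'a measure \<Rightarrow> ('n \<Rightarrow> 'a \<Rightarrow> real) \<Rightarrow> ('a \<Rightarrow> 'y) \<Rightarrow> 'y set \<Rightarrow> 'n \<Rightarrow> real" where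
  "info_class M X Y Ys s =
     diff_entropy M lborel (X s) + diff_entropy M (count_space Ys) Y
     - diff_entropy M (lborel \<Otimes>\<^sub>M count_space Ys) (\<lambda>\<omega>. (X s \<omega>, Y \<omega>))"

definition gnb_weight ::
  "'a measure \<Rightarrow> ('n::linorder \<Rightarrow> 'a \<Rightarrow> real) \<Rightarrow> ('a \<Rightarrow> 'y) \<Rightarrow> 'y set \<Rightarrow>
   'n option set set \<Rightarrow> 'n option set set \<Rightarrow> ('n option set \<Rightarrow> nat) \<Rightarrow> real" where
  "gnb_weight M X Y Ys C S \<nu> =
     (\<Sum>(i, j)\<in>cluster_pairs C. info_pair_class M X Y Ys i j)
     - (\<Sum>s\<in>separator_features S. (real (\<nu> {None, Some s}) - 1) * info_class M X Y Ys s)"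

end

theory Submission
  imports Defs
begin

text \<open>
  Within a class, the normal scores \<open>\<Phi>\<inverse>(F\<^sub>i(X\<^sub>i))\<close> have exactly the law whose distribution function
  is the Gaussian copula evaluated at \<open>\<Phi>\<close>, i.e. a multivariate normal law. Its normalizing constant
  and its relation to \<open>R\<close> never have to be computed: integrating out one coordinate at a time
  shows that a two-dimensional marginal has a density proportional to the exponential of some negative
  definite quadratic form, and the standard normal marginals of the scores then force this density to
  be the standard bivariate normal one with parameter \<open>\<rho>\<close>, which is the correlation of the scores.
  Going back through the quantile functions, the joint density of \<open>(X\<^sub>i, X\<^sub>j)\<close> is the product of the
  marginal densities and a factor whose expected logarithm is \<open>- ln (1 - \<rho>\<^sup>2) / 2\<close>. Finally, a feature
  lies in exactly one more cluster than is accounted for by its separator, so that in the weight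
  everything except these logarithms collapses to one term per feature.
\<close>

section \<open>GNB junction trees\<close>

text \<open>The copula hypothesis speaks only of orthants, through \<open>measure\<close>, and the
  total mass of \<open>multivariate_normal R\<close> is not given in advance. It must be shown
  finite before the orthant values can determine the law, because \<open>measure\<close> sends
  infinite mass to 0.

  A feature may have a c.d.f. that is constant on intervals, so the scores can be inverted only
  almost surely. For the same reason densities are transferred by comparing expectations of test
  functions instead of by a differentiable change of variables.

  The entropy of \<open>Y\<close> cancels from every information content. What remains is the
  entropy of the features minus its class average, and so only the entropies within a class have to
  be computed.

  The mutual information of a standard normal pair with correlation \<rho> is -ln(1 - \<rho>^2)/2,
  so the logarithms enter the weight with coefficient 1/2 and not 1.\<close>

lemma gnb_graph_props:
  assumes "gnb_graph V E"
  shows "None \<in> V" "\<forall>e\<in>E. e \<subseteq> V" "\<forall>v\<in>V. v \<noteq> None \<longrightarrow> {None, v} \<in> E"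
    "\<forall>s. Some s \<in> V \<longrightarrow> (\<exists>t. t \<noteq> s \<and> {Some s, Some t} \<in> E)"
    "\<forall>K. is_clique V E K \<longrightarrow> finite K \<and> card K \<le> 3"
  using assms
proof (induction rule: gnb_graph.induct)
  case (triangle i j)
  { case 1 show ?case by simp }
  { case 2 show ?case by auto }
  { case 3 show ?case by (auto simp: insert_commute) }
  { case 4 show ?case using triangle by (auto simp: doubleton_eq_iff) }
  { case 5
    show ?case
    proof (intro allI impI)
      fix K assume "is_clique {None, Some i, Some j} {{None, Some i}, {None, Some j}, {Some i, Some j}} K"
      then have "K \<subseteq> {None, Some i, Some j}"
        by (simp add: is_clique_def)
      moreover have "card {None, Some i, Some j} = 3"
        using triangle by simp
      ultimately show "finite K \<and> card K \<le> 3"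
        by (metis card_mono finite.emptyI finite.insertI finite_subset)
    qed }
next
  case (extend V E j k)
  { case 1 show ?case using extend by simp }
  { case 2 show ?case using extend by auto }
  { case 3 show ?case using extend by auto }
  { case 4
    show ?case
    proof (intro allI impI)
      fix s assume s: "Some s \<in> insert (Some k) V"
      show "\<exists>t. t \<noteq> s \<and> {Some s, Some t} \<in> E \<union> {{None, Some k}, {Some j, Some k}}"
      proof (cases "s = k")
        case True
        then show ?thesis using extend by (intro exI[of _ j]) (auto simp: insert_commute)
      next
        case False
        then show ?thesis using extend s by auto
      qed
    qed }
  { case 5
    show ?case
    proof (intro allI impI)
      fix K assume K: "is_clique (insert (Some k) V) (E \<union> {{None, Some k}, {Some j, Some k}}) K"
      show "finite K \<and> card K \<le> 3"
      proof (cases "Some k \<in> K")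
        case True
        \<comment> \<open>The only edges at the new vertex lead to \<open>None\<close> and
          \<open>Some j\<close>; this is why no clique ever gets a fourth vertex.\<close>
        have "K \<subseteq> {Some k, None, Some j}"
        proof
          fix v assume v: "v \<in> K"
          show "v \<in> {Some k, None, Some j}"
          proof (cases "v = Some k")
            case False
            then have "{v, Some k} \<in> E \<union> {{None, Some k}, {Some j, Some k}}"
              using K v True by (auto simp: is_clique_def)
            moreover have "{v, Some k} \<notin> E"
              using extend by auto
            ultimately show ?thesis by (auto simp: doubleton_eq_iff)
          qed simp
        qed
        moreover have "card {Some k, None, Some j} \<le> 3"
          by (simp add: card_insert_if)
        ultimately show ?thesis
          by (meson card_mono finite.emptyI finite.insertI finite_subset le_trans)
      next
        case False
        have "is_clique V E K"
          unfolding is_clique_def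
        proof (intro conjI ballI impI)
          show "K \<subseteq> V" using K False by (auto simp: is_clique_def)
          fix a b assume ab: "a \<in> K" "b \<in> K" "a \<noteq> b"
          then have "{a, b} \<in> E \<union> {{None, Some k}, {Some j, Some k}}"
            using K by (auto simp: is_clique_def)
          then show "{a, b} \<in> E"
            using ab False by (auto simp: doubleton_eq_iff)
        qed
        then show ?thesis using extend by blast
      qed
    qed }
qed

text \<open>The vertex \<open>None\<close> is adjacent to all others, so adding it to a clique
  leaves a clique. By maximality it already belongs to every cluster.\<close>

lemma gnb_cluster_shape:
  assumes E: "gnb_graph V E" and K: "is_maximal_clique V E K" "card K = 3"
  obtains i j where "i \<noteq> j" "K = {None, Some i, Some j}"
proof -
  note p = gnb_graph_props[OF E]
  have cl: "is_clique V E K"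
    using K by (simp add: is_maximal_clique_def)
  have "is_clique V E (insert None K)"
    unfolding is_clique_def
  proof (intro conjI ballI impI)
    show "insert None K \<subseteq> V" using cl p(1) by (auto simp: is_clique_def)
    fix a b assume "a \<in> insert None K" "b \<in> insert None K" "a \<noteq> b"
    then show "{a, b} \<in> E"
      using cl p(3) unfolding is_clique_def
      by (metis insert_commute insert_iff subset_iff)
  qed
  then have N: "None \<in> K"
    using K unfolding is_maximal_clique_def by blast
  have "card (K - {None}) = 2"
    using K(2) N by simp
  then obtain a b where ab: "K - {None} = {a, b}" "a \<noteq> b"
    by (auto simp: card_2_iff)
  then obtain i j where "a = Some i" "b = Some j"
    by (metis insertCI insert_Diff_single option.exhaust DiffE)
  then show thesis
    using that[of i j] ab N by auto
qed

text \<open>Every feature has an edge to another feature, and \<open>None\<close> completes it to a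
  triangle. The triangle is maximal because cliques have at most three vertices.\<close>

lemma gnb_feature_in_cluster:
  assumes E: "gnb_graph UNIV E"
  obtains K where "is_maximal_clique UNIV E K" "card K = 3" "{None, Some s} \<subseteq> K"
proof -
  note p = gnb_graph_props[OF E]
  obtain t where t: "t \<noteq> s" "{Some s, Some t} \<in> E"
    using p(4) by blast
  let ?K = "{None, Some s, Some t}"
  have "is_clique UNIV E ?K"
    using p(3) t unfolding is_clique_def by (auto simp: insert_commute)
  moreover have c: "card ?K = 3"
    using t by simp
  moreover have "L = ?K" if "is_clique UNIV E L" "?K \<subseteq> L" for L
    using p(5) that c by (metis card_seteq)
  ultimately have "is_maximal_clique UNIV E ?K"
    unfolding is_maximal_clique_def by blast
  then show thesis
    using c by (rule that) simp
qed

text \<open>Double counting of the incidences between features and clusters. The condition i < j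
  makes the pairs enumerate the clusters without repetition.\<close>

lemma sum_cluster_pairs:
  fixes f :: "'n::{finite, linorder} \<Rightarrow> real"
  assumes C: "\<And>K. K \<in> C \<Longrightarrow> \<exists>i j. i \<noteq> j \<and> K = {None, Some i, Some j}"
  shows "(\<Sum>(i, j)\<in>cluster_pairs C. f i + f j) = (\<Sum>s\<in>UNIV. real (card {K \<in> C. {None, Some s} \<subseteq> K}) * f s)"
proof -
  let ?c = "\<lambda>(i, j). {None, Some i, Some j}"
  have "bij_betw ?c (cluster_pairs C) C"
  proof -
    have "K \<in> ?c ` cluster_pairs C" if K: "K \<in> C" for K
    proof -
      obtain i j where ij: "i \<noteq> j" "K = {None, Some i, Some j}"
        using C[OF K] by blast
      show ?thesis
      proof (cases "i < j")
        case True
        then show ?thesis using ij K by (auto simp: cluster_pairs_def image_iff)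
      next
        case False
        then have "(j, i) \<in> cluster_pairs C"
          using ij K by (simp add: cluster_pairs_def insert_commute[of "Some j"])
        then show ?thesis using ij by (intro image_eqI[of _ _ "(j, i)"]) auto
      qed
    qed
    moreover have "inj_on ?c (cluster_pairs C)"
    proof (rule inj_onI, clarify)
      fix i j k l :: 'n
      assume ij: "(i, j) \<in> cluster_pairs C" and kl: "(k, l) \<in> cluster_pairs C"
        and eq: "{None, Some i, Some j} = {None, Some k, Some l}"
      have "{i, j} = {s. Some s \<in> {None, Some i, Some j}}" by auto
      also have "\<dots> = {k, l}" unfolding eq by auto
      finally show "i = k \<and> j = l"
        using ij kl by (auto simp: doubleton_eq_iff cluster_pairs_def)
    qed
    moreover have "?c ` cluster_pairs C \<subseteq> C"
      by (auto simp: cluster_pairs_def)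
    ultimately show ?thesis
      unfolding bij_betw_def by blast
  qed
  then have "(\<Sum>K\<in>C. \<Sum>s | Some s \<in> K. f s) = (\<Sum>x\<in>cluster_pairs C. \<Sum>s | Some s \<in> ?c x. f s)"
    by (rule sum.reindex_bij_betw[symmetric])
  also have "\<dots> = (\<Sum>(i, j)\<in>cluster_pairs C. f i + f j)"
  proof (intro sum.cong refl)
    fix x assume x: "x \<in> cluster_pairs C"
    obtain i j where ij: "x = (i, j)" by (cases x)
    have "{s. Some s \<in> ?c x} = {i, j}" by (auto simp: ij)
    moreover have "i \<noteq> j" using x by (auto simp: ij cluster_pairs_def)
    ultimately show "(\<Sum>s | Some s \<in> ?c x. f s) = (case x of (i, j) \<Rightarrow> f i + f j)"
      by (simp add: ij)
  qed
  finally have "(\<Sum>(i, j)\<in>cluster_pairs C. f i + f j) = (\<Sum>K\<in>C. \<Sum>s | Some s \<in> K. f s)" ..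
  also have "\<dots> = (\<Sum>K\<in>C. \<Sum>s\<in>UNIV. if Some s \<in> K then f s else 0)"
    by (simp add: sum.If_cases)
  also have "\<dots> = (\<Sum>s\<in>UNIV. \<Sum>K\<in>C. if Some s \<in> K then f s else 0)"
    by (rule sum.swap)
  also have "\<dots> = (\<Sum>s\<in>UNIV. real (card {K \<in> C. {None, Some s} \<subseteq> K}) * f s)"
  proof (rule sum.cong)
    fix s :: 'n
    have "{K \<in> C. {None, Some s} \<subseteq> K} = C \<inter> {K. Some s \<in> K}"
      using C by blast
    then show "(\<Sum>K\<in>C. if Some s \<in> K then f s else 0) = real (card {K \<in> C. {None, Some s} \<subseteq> K}) * f s"
      by (simp add: sum.If_cases)
  qed simp
  finally show ?thesis .
qed

lemma is_treeD: "is_tree N E \<Longrightarrow> a \<in> N \<Longrightarrow> b \<in> N \<Longrightarrow> (a, b) \<in> {(u, v). {u, v} \<in> E}\<^sup>*"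
  by (simp add: is_tree_def)

text \<open>The multiplicity of a separator is its number of clusters by definition, so the point is
  a feature that is no separator. It lies in exactly one cluster: the clusters containing
  \<open>{None, Some s}\<close> are connected in \<open>T\<close>, and an edge between two of them
  would make this pair a separator.\<close>

lemma gnb_junction_tree_sum:
  fixes f :: "'n::{finite, linorder} \<Rightarrow> real"
  assumes "gnb_junction_tree UNIV C S \<nu>"
  shows "(\<Sum>(i, j)\<in>cluster_pairs C. f i + f j)
    - (\<Sum>s\<in>separator_features S. (real (\<nu> {None, Some s}) - 1) * f s) = (\<Sum>s\<in>UNIV. f s)"
proof -
  obtain E T where E: "gnb_graph UNIV E"
    and C: "C = {K. is_maximal_clique UNIV E K \<and> card K = 3}"
    and T: "\<forall>K L. {K, L} \<in> T \<longrightarrow> card (K \<inter> L) = 2"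
    and P: "\<forall>P. card P = 2 \<longrightarrow> is_tree {K \<in> C. P \<subseteq> K} {e \<in> T. e \<subseteq> {K \<in> C. P \<subseteq> K}}"
    and S: "S = {K \<inter> L | K L. {K, L} \<in> T}"
    and \<nu>: "\<forall>s\<in>S. \<nu> s = card {K \<in> C. s \<subseteq> K}"
    using assms unfolding gnb_junction_tree_def by (elim exE conjE) (rule that)
  define deg where "deg s = card {K \<in> C. {None, Some s} \<subseteq> K}" for s
  have deg1: "deg s = 1" if s: "s \<notin> separator_features S" for s
  proof -
    let ?D = "{K \<in> C. {None, Some s} \<subseteq> K}"
    obtain K where K: "K \<in> ?D"
      unfolding C by (rule gnb_feature_in_cluster[OF E, of s]) simp
    have "?D \<subseteq> {K}"
    proof
      fix L assume L: "L \<in> ?D"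
      have "K = L"
      proof (rule ccontr)
        assume "K \<noteq> L"
        have "is_tree ?D {e \<in> T. e \<subseteq> ?D}"
          by (rule P[rule_format]) simp
        then have "(L, K) \<in> {(u, v). {u, v} \<in> {e \<in> T. e \<subseteq> ?D}}\<^sup>*"
          using K L by (intro is_treeD)
        then obtain A where A: "{L, A} \<in> T" "{L, A} \<subseteq> ?D"
        proof (cases rule: converse_rtranclE)
          case base
          with \<open>K \<noteq> L\<close> show thesis by simp
        next
          case (step A)
          then have "{L, A} \<in> {e \<in> T. e \<subseteq> ?D}" by (simp only: mem_Collect_eq prod.case)
          then have "{L, A} \<in> T" "{L, A} \<subseteq> ?D" by (simp_all only: mem_Collect_eq)
          then show thesis by (rule that)
        qed
        have "card (L \<inter> A) = 2"
          using A(1) T by blast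
        moreover have "{None, Some s} \<subseteq> L \<inter> A"
          using A(2) by (simp only: insert_subset mem_Collect_eq Int_iff empty_subsetI simp_thms)
        moreover have "card {None, Some s} = 2" by simp
        moreover have "finite (L \<inter> A)" by simp
        \<comment> \<open>Connected clusters meet in two vertices, and both contain this pair, so
          the pair is the whole intersection.\<close>
        ultimately have "L \<inter> A = {None, Some s}"
          by (metis card_subset_eq)
        moreover have "L \<inter> A \<in> S"
          unfolding S by (intro CollectI exI[of _ L] exI[of _ A]) (simp add: A(1))
        ultimately have "{None, Some s} \<in> S" by (rule subst)
        with s show False by (simp add: separator_features_def)
      qed
      then show "L \<in> {K}" by (rule subst) (rule singletonI)
    qed
    moreover have "{K} \<subseteq> ?D" using K by (rule insert_subset[THEN iffD2, OF conjI]) (rule empty_subsetI)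
    ultimately have "?D = {K}" by (rule equalityI)
    then show ?thesis by (simp add: deg_def)
  qed
  have "(\<Sum>s\<in>separator_features S. (real (\<nu> {None, Some s}) - 1) * f s)
      = (\<Sum>s\<in>separator_features S. (real (deg s) - 1) * f s)"
    using \<nu> by (intro sum.cong) (simp_all add: separator_features_def deg_def)
  \<comment> \<open>The features outside the separators have \<open>deg s = 1\<close> and add
    zero.\<close>
  also have "\<dots> = (\<Sum>s\<in>UNIV. (real (deg s) - 1) * f s)"
    by (intro sum.mono_neutral_left) (auto simp: deg1)
  also have "\<dots> = (\<Sum>s\<in>UNIV. real (deg s) * f s) - (\<Sum>s\<in>UNIV. f s)"
    by (simp add: algebra_simps sum_subtractf)
  moreover have "(\<Sum>(i, j)\<in>cluster_pairs C. f i + f j) = (\<Sum>s\<in>UNIV. real (deg s) * f s)"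
    unfolding deg_def
  proof (rule sum_cluster_pairs)
    fix K assume "K \<in> C"
    then have "is_maximal_clique UNIV E K" "card K = 3" by (simp_all add: C)
    then obtain i j where "i \<noteq> j" "K = {None, Some i, Some j}"
      by (rule gnb_cluster_shape[OF E])
    then show "\<exists>i j. i \<noteq> j \<and> K = {None, Some i, Some j}"
      by (intro exI conjI)
  qed
  ultimately show ?thesis by simp
qed


section \<open>Marginals of Gaussian densities\<close>

text \<open>Coefficients are functions on an arbitrary index type and not matrices, so that
  coordinates can be removed one at a time without a change of type.\<close>

definition quad :: "'b set \<Rightarrow> ('b \<Rightarrow> 'b \<Rightarrow> real) \<Rightarrow> ('b \<Rightarrow> real) \<Rightarrow> real" where
  "quad I a x = (\<Sum>k\<in>I. \<Sum>l\<in>I. a k l * x k * x l)"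

definition pos_def_on :: "'b set \<Rightarrow> ('b \<Rightarrow> 'b \<Rightarrow> real) \<Rightarrow> bool" where
  "pos_def_on I a \<longleftrightarrow> (\<forall>k l. a k l = a l k) \<and> (\<forall>x. (\<exists>k\<in>I. x k \<noteq> 0) \<longrightarrow> quad I a x > 0)"

definition schur :: "('b \<Rightarrow> 'b \<Rightarrow> real) \<Rightarrow> 'b \<Rightarrow> 'b \<Rightarrow> 'b \<Rightarrow> real" where
  "schur a k l m = a l m - a k l * a k m / a k k"

lemma quad_cong: "(\<And>k. k \<in> I \<Longrightarrow> x k = y k) \<Longrightarrow> quad I a x = quad I a y"
  by (simp add: quad_def)

text \<open>Completing the square in \<open>x k\<close>; the form that remains does not involve this
  coordinate.\<close>

lemma quad_insert:
  assumes I: "finite I" "k \<notin> I" and a: "\<And>k l. a k l = a l k" and k: "a k k \<noteq> 0"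
  shows "quad (insert k I) a x =
    quad I (schur a k) x + a k k * (x k + (\<Sum>l\<in>I. a k l * x l) / a k k)\<^sup>2"
proof -
  define s where "s = (\<Sum>l\<in>I. a k l * x l)"
  have 1: "(\<Sum>l\<in>I. a k l * x k * x l) = x k * s" "(\<Sum>l\<in>I. a l k * x l * x k) = x k * s"
    by (simp_all add: s_def sum_distrib_left mult_ac a[of _ k])
  have "quad (insert k I) a x = a k k * x k * x k + x k * s + (x k * s + quad I a x)"
    using I by (simp add: quad_def sum.distrib 1)
  moreover have "quad I (schur a k) x = quad I a x - s * s / a k k"
    unfolding quad_def schur_def s_def sum_product sum_divide_distrib sum_subtractf[symmetric]
    by (intro sum.cong) (auto simp: algebra_simps)
  moreover have "a k k * (x k + s / a k k)\<^sup>2 = a k k * x k * x k + 2 * x k * s + s * s / a k k"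
    using k by (simp add: power2_eq_square field_simps)
  ultimately show ?thesis
    by (simp add: s_def[symmetric])
qed

lemma pos_def_on_diag:
  assumes "pos_def_on I a" "k \<in> I" "finite I"
  shows "a k k > 0"
proof -
  have "quad I a (\<lambda>l. if l = k then 1 else 0) > 0"
    using assms by (intro assms(1)[unfolded pos_def_on_def, THEN conjunct2, rule_format] bexI[of _ k]) auto
  also have "quad I a (\<lambda>l. if l = k then 1 else 0) = a k k"
    using assms by (simp add: quad_def if_distrib[of "\<lambda>u. _ * u"] sum.delta cong: if_cong)
  finally show ?thesis .
qed

text \<open>The Schur form at \<open>x\<close> is the full form at \<open>x\<close> extended by the
  value of coordinate \<open>k\<close> that annihilates the completed square.\<close>

lemma pos_def_on_schur:
  assumes p: "pos_def_on (insert k I) a" and I: "finite I" "k \<notin> I"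
  shows "pos_def_on I (schur a k)"
proof -
  have sym: "\<And>k l. a k l = a l k" using p by (auto simp: pos_def_on_def)
  have k: "a k k > 0" using pos_def_on_diag[OF p] I by simp
  have "quad I (schur a k) x > 0" if x: "\<exists>l\<in>I. x l \<noteq> 0" for x
  proof -
    define y where "y = x(k := - (\<Sum>l\<in>I. a k l * x l) / a k k)"
    have yx: "\<And>l. l \<in> I \<Longrightarrow> y l = x l" using I by (auto simp: y_def)
    have "quad (insert k I) a y > 0"
      using p x yx unfolding pos_def_on_def by (metis insertCI)
    moreover have "quad (insert k I) a y = quad I (schur a k) x"
      using k sym by (subst quad_insert[OF I])
        (auto simp: yx quad_cong[OF yx] y_def[THEN fun_cong, of k] intro!: disjI2)
    ultimately show ?thesis by simp
  qed
  then show ?thesis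
    by (auto simp: pos_def_on_def schur_def sym mult.commute)
qed

section \<open>Integrating out coordinates of a Gaussian\<close>

lemma nn_integral_exp_quadratic:
  fixes a m :: real
  assumes a: "a > 0"
  shows "(\<integral>\<^sup>+t. ennreal (exp (- (a * (t + m)\<^sup>2) / 2)) \<partial>lborel) = ennreal (sqrt (2 * pi / a))"
proof -
  \<comment> \<open>The integrand is a multiple of the normal density with mean -m and variance 1/a,
    whose integral is known.\<close>
  have "exp (- (a * (t + m)\<^sup>2) / 2) = sqrt (2 * pi / a) * normal_density (-m) (1 / sqrt a) t" for t
  proof -
    have "(1 / sqrt a)\<^sup>2 = 1 / a" using a by (simp add: power_divide)
    moreover have "sqrt (2 * pi / a) \<noteq> 0" using a by simp
    moreover have "(t + m)\<^sup>2 / (2 * (1 / a)) = a * (t + m)\<^sup>2 / 2" using a by simp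
    ultimately show ?thesis
      by (simp add: normal_density_def)
  qed
  then have "(\<integral>\<^sup>+t. ennreal (exp (- (a * (t + m)\<^sup>2) / 2)) \<partial>lborel)
      = ennreal (sqrt (2 * pi / a)) * (\<integral>\<^sup>+t. ennreal (normal_density (-m) (1 / sqrt a) t) \<partial>lborel)"
    using a by (simp add: ennreal_mult' nn_integral_cmult)
  also have "(\<integral>\<^sup>+t. ennreal (normal_density (-m) (1 / sqrt a) t) \<partial>lborel) = 1"
    using a by (subst nn_integral_eq_integral) auto
  finally show ?thesis by simp
qed

interpretation lborel_PiM: product_sigma_finite "\<lambda>_::'b. lborel :: real measure" ..

text \<open>The test function does not see coordinate \<open>k\<close>. After completing the square
  the inner integral is a shifted one-dimensional Gaussian, and its value does not depend on the
  shift, hence not on the other coordinates.\<close>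

lemma nn_integral_exp_quad_insert:
  fixes h :: "('b \<Rightarrow> real) \<Rightarrow> ennreal"
  assumes I: "finite I" "k \<notin> I" and p: "pos_def_on (insert k I) a"
    and h: "h \<in> borel_measurable (Pi\<^sub>M I (\<lambda>_. lborel))"
  shows "(\<integral>\<^sup>+x. h (restrict x I) * ennreal (exp (- quad (insert k I) a x / 2)) \<partial>Pi\<^sub>M (insert k I) (\<lambda>_. lborel))
    = ennreal (sqrt (2 * pi / a k k)) *
      (\<integral>\<^sup>+x. h x * ennreal (exp (- quad I (schur a k) x / 2)) \<partial>Pi\<^sub>M I (\<lambda>_. lborel))"
proof -
  have sym: "\<And>k l. a k l = a l k" using p by (auto simp: pos_def_on_def)
  have k: "a k k > 0" using pos_def_on_diag[OF p] I by simp
  note [measurable] = h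
  have [measurable]: "(\<lambda>x. h (restrict x I)) \<in> borel_measurable (Pi\<^sub>M (insert k I) (\<lambda>_. lborel))"
    by (rule measurable_compose[OF measurable_restrict_subset h]) auto
  have "(\<integral>\<^sup>+x. h (restrict x I) * ennreal (exp (- quad (insert k I) a x / 2)) \<partial>Pi\<^sub>M (insert k I) (\<lambda>_. lborel))
    = (\<integral>\<^sup>+x. \<integral>\<^sup>+t. h (restrict (x(k := t)) I) * ennreal (exp (- quad (insert k I) a (x(k := t)) / 2)) \<partial>lborel \<partial>Pi\<^sub>M I (\<lambda>_. lborel))"
    using I by (intro lborel_PiM.product_nn_integral_insert) (auto simp: quad_def)
  also have "\<dots> = (\<integral>\<^sup>+x. ennreal (sqrt (2 * pi / a k k)) * (h x * ennreal (exp (- quad I (schur a k) x / 2))) \<partial>Pi\<^sub>M I (\<lambda>_. lborel))"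
  proof (rule nn_integral_cong)
    fix x assume x: "x \<in> space (Pi\<^sub>M I (\<lambda>_. lborel :: real measure))"
    define s where "s = (\<Sum>l\<in>I. a k l * x l) / a k k"
    have r: "restrict (x(k := t)) I = x" for t
      using x I by (auto simp: space_PiM PiE_def extensional_def fun_eq_iff restrict_def)
    have q: "quad (insert k I) a (x(k := t)) = quad I (schur a k) x + a k k * (t + s)\<^sup>2" for t
    proof -
      have "quad I (schur a k) (x(k := t)) = quad I (schur a k) x"
        using I by (intro quad_cong) auto
      moreover have "(\<Sum>l\<in>I. a k l * (x(k := t)) l) = (\<Sum>l\<in>I. a k l * x l)"
        using I by (intro sum.cong) auto
      ultimately show ?thesis
        using quad_insert[OF I, of a "x(k := t)"] sym k by (simp add: s_def)
    qed
    have "h x * ennreal (exp (- (quad I (schur a k) x + a k k * (t + s)\<^sup>2) / 2))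
        = (h x * ennreal (exp (- quad I (schur a k) x / 2))) * ennreal (exp (- (a k k * (t + s)\<^sup>2) / 2))" for t
      by (simp add: mult.assoc ennreal_mult'[symmetric] exp_add[symmetric] add_divide_distrib[symmetric])
        (simp add: field_simps)
    then show "(\<integral>\<^sup>+t. h (restrict (x(k := t)) I) * ennreal (exp (- quad (insert k I) a (x(k := t)) / 2)) \<partial>lborel)
        = ennreal (sqrt (2 * pi / a k k)) * (h x * ennreal (exp (- quad I (schur a k) x / 2)))"
      unfolding r q by (simp add: nn_integral_cmult nn_integral_exp_quadratic[OF k, simplified] mult_ac)
  qed
  also have "\<dots> = ennreal (sqrt (2 * pi / a k k)) *
      (\<integral>\<^sup>+x. h x * ennreal (exp (- quad I (schur a k) x / 2)) \<partial>Pi\<^sub>M I (\<lambda>_. lborel))"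
    by (rule nn_integral_cmult) (auto simp: quad_def)
  finally show ?thesis .
qed

text \<open>Testing against all \<open>h\<close> records the whole marginal law. The form
  \<open>b\<close> and the constant \<open>c\<close> are left unspecified on purpose: the marginals
  of the scores determine them later.\<close>

lemma nn_integral_exp_quad_marginal:
  fixes a :: "'b \<Rightarrow> 'b \<Rightarrow> real"
  assumes "finite J" "finite K" "J \<inter> K = {}" "pos_def_on (J \<union> K) a"
  shows "\<exists>b c. pos_def_on K b \<and> 0 < c \<and> (\<forall>h \<in> borel_measurable (Pi\<^sub>M K (\<lambda>_. lborel)).
    (\<integral>\<^sup>+x. h (restrict x K) * ennreal (exp (- quad (J \<union> K) a x / 2)) \<partial>Pi\<^sub>M (J \<union> K) (\<lambda>_. lborel))
    = ennreal c * (\<integral>\<^sup>+x. h x * ennreal (exp (- quad K b x / 2)) \<partial>Pi\<^sub>M K (\<lambda>_. lborel)))"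
  using assms
proof (induction J arbitrary: a rule: finite_induct)
  case empty
  have "(\<integral>\<^sup>+x. h (restrict x K) * ennreal (exp (- quad K a x / 2)) \<partial>Pi\<^sub>M K (\<lambda>_. lborel))
      = (\<integral>\<^sup>+x. h x * ennreal (exp (- quad K a x / 2)) \<partial>Pi\<^sub>M K (\<lambda>_. lborel))" for h :: "('b \<Rightarrow> real) \<Rightarrow> ennreal"
    by (intro nn_integral_cong) (auto simp: space_PiM PiE_def extensional_restrict)
  then show ?case
    using empty by (intro exI[of _ a] exI[of _ 1]) (simp only: Un_empty_left ennreal_1 mult_1 ball_triv simp_thms zero_less_one)
next
  case (insert k J)
  have k: "finite (J \<union> K)" "k \<notin> J \<union> K" "pos_def_on (insert k (J \<union> K)) a"
    using insert by auto
  obtain b c where bc: "pos_def_on K b" "0 < c" and eq: "\<And>h. h \<in> borel_measurable (Pi\<^sub>M K (\<lambda>_. lborel)) \<Longrightarrow>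
    (\<integral>\<^sup>+x. h (restrict x K) * ennreal (exp (- quad (J \<union> K) (schur a k) x / 2)) \<partial>Pi\<^sub>M (J \<union> K) (\<lambda>_. lborel))
    = ennreal c * (\<integral>\<^sup>+x. h x * ennreal (exp (- quad K b x / 2)) \<partial>Pi\<^sub>M K (\<lambda>_. lborel))"
    using insert.IH[OF _ _ pos_def_on_schur[OF k(3,1,2)]] insert.prems by blast
  have d: "a k k > 0"
    using pos_def_on_diag[OF k(3)] k(1) by simp
  show ?case
  proof (intro exI[of _ b] exI[of _ "sqrt (2 * pi / a k k) * c"] conjI ballI)
    show "0 < sqrt (2 * pi / a k k) * c" using d bc by simp
    fix h :: "('b \<Rightarrow> real) \<Rightarrow> ennreal" assume h: "h \<in> borel_measurable (Pi\<^sub>M K (\<lambda>_. lborel))"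
    have m: "(\<lambda>x. h (restrict x K)) \<in> borel_measurable (Pi\<^sub>M (J \<union> K) (\<lambda>_. lborel))"
      by (rule measurable_compose[OF measurable_restrict_subset h]) auto
    have r: "restrict (restrict x (J \<union> K)) K = restrict x K" for x :: "'b \<Rightarrow> real"
      by (simp add: Int_absorb1)
    show "(\<integral>\<^sup>+x. h (restrict x K) * ennreal (exp (- quad (insert k J \<union> K) a x / 2)) \<partial>Pi\<^sub>M (insert k J \<union> K) (\<lambda>_. lborel))
      = ennreal (sqrt (2 * pi / a k k) * c) * (\<integral>\<^sup>+x. h x * ennreal (exp (- quad K b x / 2)) \<partial>Pi\<^sub>M K (\<lambda>_. lborel))"
      using nn_integral_exp_quad_insert[OF k m] eq[OF h] d bc
      by (simp add: r ennreal_mult mult.assoc)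
  qed (use bc in simp)
qed

section \<open>From matrices to quadratic forms\<close>

lemma correlation_matrix_inv_pos:
  fixes R :: "real^'n^'n"
  assumes R: "correlation_matrix R" and z: "z \<noteq> 0"
  shows "z \<bullet> (matrix_inv R *v z) > 0"
proof -
  have "x = 0" if "R *v x = 0" for x
    using R that unfolding correlation_matrix_def by (metis inner_zero_right less_irrefl)
  then have "\<exists>B. B ** R = mat 1"
    by (simp add: matrix_left_invertible_ker)
  then have "invertible R"
    by (simp add: invertible_left_inverse)
  then have "R ** matrix_inv R = mat 1"
    unfolding invertible_def matrix_inv_def by (rule someI_ex[THEN conjunct1])
  then have Rz: "R *v (matrix_inv R *v z) = z"
    by (simp add: matrix_vector_mul_assoc)
  then have "matrix_inv R *v z \<noteq> 0"
    using z by (metis matrix_vector_mult_0_right)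
  \<comment> \<open>With w the image of z under the inverse, the form of the inverse at z is the
    form of \<open>R\<close> at w.\<close>
  then have "(matrix_inv R *v z) \<bullet> (R *v (matrix_inv R *v z)) > 0"
    using R by (simp add: correlation_matrix_def)
  then show ?thesis by (simp add: Rz inner_commute)
qed

text \<open>Averaging \<open>A\<close> with its transpose leaves the quadratic form unchanged and
  supplies the symmetry that \<open>pos_def_on\<close> asks for.\<close>

lemma quad_Basis:
  fixes A :: "real^'n^'n" and f :: "real^'n \<Rightarrow> real"
  defines "a \<equiv> \<lambda>k l. (k \<bullet> (A *v l) + l \<bullet> (A *v k)) / 2"
  defines "z \<equiv> \<Sum>b\<in>Basis. f b *\<^sub>R b"
  shows "quad Basis a f = z \<bullet> (A *v z)"
proof -
  have "A *v z = (\<Sum>l\<in>Basis. f l *\<^sub>R (A *v l))"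
    unfolding z_def using matrix_vector_mul_linear[of A] by (simp add: linear_sum linear_scale)
  then have "z \<bullet> (A *v z) = (\<Sum>l\<in>Basis. f l * (z \<bullet> (A *v l)))"
    by (simp add: inner_sum_right)
  also have "\<dots> = (\<Sum>l\<in>Basis. \<Sum>k\<in>Basis. f k * f l * (k \<bullet> (A *v l)))"
    by (simp add: z_def inner_sum_left sum_distrib_left mult_ac)
  finally have "z \<bullet> (A *v z) = (\<Sum>k\<in>Basis. \<Sum>l\<in>Basis. f k * f l * (k \<bullet> (A *v l)))"
    by (subst sum.swap)
  moreover from this have "z \<bullet> (A *v z) = (\<Sum>k\<in>Basis. \<Sum>l\<in>Basis. f k * f l * (l \<bullet> (A *v k)))"
    by (subst sum.swap) (simp add: mult_ac)
  moreover have "quad Basis a f = ((\<Sum>k\<in>Basis. \<Sum>l\<in>Basis. f k * f l * (k \<bullet> (A *v l)))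
      + (\<Sum>k\<in>Basis. \<Sum>l\<in>Basis. f k * f l * (l \<bullet> (A *v k)))) / 2"
    unfolding quad_def a_def sum.distrib[symmetric] sum_divide_distrib
    by (intro sum.cong refl) (simp add: algebra_simps)
  ultimately show ?thesis by simp
qed

lemma pos_def_on_Basis:
  fixes A :: "real^'n^'n"
  assumes "\<And>z. z \<noteq> 0 \<Longrightarrow> z \<bullet> (A *v z) > 0"
  shows "pos_def_on Basis (\<lambda>k l. (k \<bullet> (A *v l) + l \<bullet> (A *v k)) / 2)"
  unfolding pos_def_on_def
proof (intro conjI allI impI)
  fix f :: "real^'n \<Rightarrow> real" assume "\<exists>k\<in>Basis. f k \<noteq> 0"
  then obtain k where k: "k \<in> Basis" "f k \<noteq> 0" by blast
  then have "(\<Sum>b\<in>Basis. f b *\<^sub>R b) \<bullet> k \<noteq> 0" by (simp add: inner_sum_left_Basis)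
  then have "(\<Sum>b\<in>Basis. f b *\<^sub>R b) \<noteq> 0" by (metis inner_zero_left)
  then show "quad Basis (\<lambda>k l. (k \<bullet> (A *v l) + l \<bullet> (A *v k)) / 2) f > 0"
    unfolding quad_Basis by (rule assms)
qed (simp add: add.commute)

text \<open>All coordinates except \<open>i\<close> and \<open>j\<close> are integrated out, and the
  normalizing factor disappears into the unspecified \<open>c\<close>. The condition on \<alpha> -
  \<beta>^2/\<gamma> is positivity of the Schur complement of the remaining form in two
  variables.\<close>

lemma multivariate_normal_pair:
  fixes R :: "real^'n^'n"
  assumes R: "correlation_matrix R" and ij: "i \<noteq> j"
  obtains c :: ennreal and \<alpha> \<beta> \<gamma> :: real where "c < \<top>" "\<alpha> > 0" "\<gamma> > 0" "\<alpha> - \<beta>\<^sup>2 / \<gamma> > 0"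
    "\<And>h. h \<in> borel_measurable (lborel \<Otimes>\<^sub>M lborel) \<Longrightarrow> (\<integral>\<^sup>+z. h (z $ i, z $ j) \<partial>multivariate_normal R) =
      c * (\<integral>\<^sup>+p. h p * ennreal (exp (- (\<alpha> * (fst p)\<^sup>2 + 2 * \<beta> * fst p * snd p + \<gamma> * (snd p)\<^sup>2) / 2))
        \<partial>(lborel \<Otimes>\<^sub>M lborel))"
proof -
  define A where "A = matrix_inv R"
  define a where "a k l = (k \<bullet> (A *v l) + l \<bullet> (A *v k)) / 2" for k l
  let ?k = "axis i (1::real)" and ?l = "axis j (1::real)"
  let ?K = "{?k, ?l}" and ?B = "Basis :: (real^'n) set"
  let ?s = "sqrt ((2 * pi) ^ CARD('n) * det R)"
  have kl: "?k \<in> ?B" "?l \<in> ?B" "?k \<noteq> ?l"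
    using ij by (auto simp: axis_in_Basis_iff axis_eq_axis)
  have B: "(?B - ?K) \<union> ?K = ?B" using kl by auto
  have "pos_def_on ?B a"
    unfolding a_def[abs_def] A_def by (rule pos_def_on_Basis[OF correlation_matrix_inv_pos[OF R]])
  then have "pos_def_on ((?B - ?K) \<union> ?K) a" unfolding B .
  then obtain b c where b: "pos_def_on ?K b" and c: "0 < c"
    and marg: "\<forall>h \<in> borel_measurable (Pi\<^sub>M ?K (\<lambda>_. lborel)).
      (\<integral>\<^sup>+x. h (restrict x ?K) * ennreal (exp (- quad ((?B - ?K) \<union> ?K) a x / 2)) \<partial>Pi\<^sub>M ((?B - ?K) \<union> ?K) (\<lambda>_. lborel))
      = ennreal c * (\<integral>\<^sup>+x. h x * ennreal (exp (- quad ?K b x / 2)) \<partial>Pi\<^sub>M ?K (\<lambda>_. lborel))"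
    using nn_integral_exp_quad_marginal[of "?B - ?K" ?K a] by auto
  define \<alpha> \<beta> \<gamma> where "\<alpha> = b ?k ?k" and "\<beta> = b ?k ?l" and "\<gamma> = b ?l ?l"
  have pos: "\<alpha> > 0" "\<gamma> > 0"
    unfolding \<alpha>_def \<gamma>_def by (rule pos_def_on_diag[OF b]; simp)+
  have bsym: "b ?l ?k = b ?k ?l" using b by (simp add: pos_def_on_def)
  have "pos_def_on (insert ?l {?k}) b" using b by (simp add: insert_commute)
  then have "pos_def_on {?k} (schur b ?l)"
    by (rule pos_def_on_schur) (use kl in auto)
  then have "schur b ?l ?k ?k > 0" by (rule pos_def_on_diag) simp_all
  then have det: "\<alpha> - \<beta>\<^sup>2 / \<gamma> > 0"
    by (simp add: schur_def \<alpha>_def \<beta>_def \<gamma>_def bsym power2_eq_square)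
  have q: "quad ?K b x = \<alpha> * (x ?k)\<^sup>2 + 2 * \<beta> * x ?k * x ?l + \<gamma> * (x ?l)\<^sup>2" for x
    using kl by (simp add: quad_def \<alpha>_def \<beta>_def \<gamma>_def bsym power2_eq_square)
  have "(\<integral>\<^sup>+z. h (z $ i, z $ j) \<partial>multivariate_normal R) =
      ennreal (1 / ?s) * ennreal c * (\<integral>\<^sup>+p. h p * ennreal (exp (- (\<alpha> * (fst p)\<^sup>2 + 2 * \<beta> * fst p * snd p + \<gamma> * (snd p)\<^sup>2) / 2))
        \<partial>(lborel \<Otimes>\<^sub>M lborel))" if h: "h \<in> borel_measurable (lborel \<Otimes>\<^sub>M lborel)" for h
  proof -
    note [measurable] = h
    have [measurable]: "(\<lambda>z. z \<bullet> (A *v z)) \<in> borel_measurable borel" "(\<lambda>z::real^'n. z $ k) \<in> borel_measurable borel" for k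
      by (intro borel_measurable_continuous_onI continuous_intros matrix_vector_mult_linear_continuous_on)+
    have [measurable]: "(\<lambda>f. \<Sum>b\<in>Basis. f b *\<^sub>R b :: real^'n) \<in> measurable (Pi\<^sub>M ?B (\<lambda>_. lborel)) borel"
      by simp
    \<comment> \<open>Lebesgue measure on vectors is the image of the product measure indexed by
      \<open>Basis\<close>; there the coordinates \<open>i\<close> and \<open>j\<close> have the
      indices \<open>axis i 1\<close> and \<open>axis j 1\<close>.\<close>
    have lb: "(lborel :: (real^'n) measure) = distr (Pi\<^sub>M ?B (\<lambda>_. lborel)) borel (\<lambda>f. \<Sum>b\<in>Basis. f b *\<^sub>R b)"
      by (rule lborel_eq)
    have e: "ennreal (exp t / ?s) = ennreal (1 / ?s) * ennreal (exp t)" for t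
      by (subst ennreal_mult''[symmetric]) simp_all
    have "(\<integral>\<^sup>+z. h (z $ i, z $ j) \<partial>multivariate_normal R)
      = (\<integral>\<^sup>+z. ennreal (exp (- (z \<bullet> (A *v z)) / 2) / ?s) * h (z $ i, z $ j) \<partial>lborel)"
      unfolding multivariate_normal_def A_def[symmetric] by (rule nn_integral_density) simp_all
    also have "\<dots> = (\<integral>\<^sup>+z. ennreal (1 / ?s) * (h (z $ i, z $ j) * ennreal (exp (- (z \<bullet> (A *v z)) / 2))) \<partial>lborel)"
      by (intro nn_integral_cong) (simp only: e, simp only: mult_ac)
    also have "\<dots> = ennreal (1 / ?s) * (\<integral>\<^sup>+z. h (z $ i, z $ j) * ennreal (exp (- (z \<bullet> (A *v z)) / 2)) \<partial>lborel)"
      by (rule nn_integral_cmult) simp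
    also have "(\<integral>\<^sup>+z. h (z $ i, z $ j) * ennreal (exp (- (z \<bullet> (A *v z)) / 2)) \<partial>lborel)
      = (\<integral>\<^sup>+f. h (f ?k, f ?l) * ennreal (exp (- quad ?B a f / 2)) \<partial>Pi\<^sub>M ?B (\<lambda>_. lborel))"
      unfolding lb
      by (subst nn_integral_distr)
         (simp_all add: a_def[abs_def] quad_Basis cart_eq_inner_axis inner_sum_left_Basis kl)
    also have "\<dots> = (\<integral>\<^sup>+f. (\<lambda>f. h (f ?k, f ?l)) (restrict f ?K) * ennreal (exp (- quad ((?B - ?K) \<union> ?K) a f / 2)) \<partial>Pi\<^sub>M ((?B - ?K) \<union> ?K) (\<lambda>_. lborel))"
      unfolding B by simp
    also have "\<dots> = ennreal c * (\<integral>\<^sup>+x. (\<lambda>f. h (f ?k, f ?l)) x * ennreal (exp (- quad ?K b x / 2)) \<partial>Pi\<^sub>M ?K (\<lambda>_. lborel))"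
      by (rule bspec[OF marg]) simp
    also have "(\<integral>\<^sup>+x. (\<lambda>f. h (f ?k, f ?l)) x * ennreal (exp (- quad ?K b x / 2)) \<partial>Pi\<^sub>M ?K (\<lambda>_. lborel))
      = (\<integral>\<^sup>+p. h p * ennreal (exp (- (\<alpha> * (fst p)\<^sup>2 + 2 * \<beta> * fst p * snd p + \<gamma> * (snd p)\<^sup>2) / 2))
        \<partial>(lborel \<Otimes>\<^sub>M lborel))"
      unfolding q
      using lborel_PiM.product_nn_integral_pair[of "\<lambda>u w. h (u, w) * ennreal (exp (- (\<alpha> * u\<^sup>2 + 2 * \<beta> * u * w + \<gamma> * w\<^sup>2) / 2))", OF _ kl(3)]
      by simp
    finally show ?thesis by (simp add: mult.assoc)
  qed
  moreover have "ennreal (1 / ?s) * ennreal c < \<top>" by (simp add: ennreal_mult_less_top)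
  ultimately show thesis by (intro that[OF _ pos det])
qed

text \<open>The total mass is the pair law tested on the constant 1; completing the square in
  \<open>w\<close> reduces it to two one-dimensional Gaussian integrals.\<close>

lemma finite_measure_multivariate_normal:
  fixes R :: "real^'n^'n"
  assumes R: "correlation_matrix R" and ij: "(i::'n) \<noteq> j"
  shows "finite_measure (multivariate_normal R)"
proof (rule multivariate_normal_pair[OF R ij])
  fix c :: ennreal and \<alpha> \<beta> \<gamma> :: real
  assume c: "c < \<top>" and pos: "\<alpha> > 0" "\<gamma> > 0" "\<alpha> - \<beta>\<^sup>2 / \<gamma> > 0"
    and law: "\<And>h. h \<in> borel_measurable (lborel \<Otimes>\<^sub>M lborel) \<Longrightarrow> (\<integral>\<^sup>+z. h (z $ i, z $ j) \<partial>multivariate_normal R) =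
      c * (\<integral>\<^sup>+p. h p * ennreal (exp (- (\<alpha> * (fst p)\<^sup>2 + 2 * \<beta> * fst p * snd p + \<gamma> * (snd p)\<^sup>2) / 2))
        \<partial>(lborel \<Otimes>\<^sub>M lborel))"
  define \<delta> where "\<delta> = \<alpha> - \<beta>\<^sup>2 / \<gamma>"
  have split: "ennreal (exp (- (\<alpha> * u\<^sup>2 + 2 * \<beta> * u * w + \<gamma> * w\<^sup>2) / 2))
      = ennreal (exp (- (\<delta> * (u + 0)\<^sup>2) / 2)) * ennreal (exp (- (\<gamma> * (w + \<beta> * u / \<gamma>)\<^sup>2) / 2))" for u w
  proof -
    have "\<alpha> * u\<^sup>2 + 2 * \<beta> * u * w + \<gamma> * w\<^sup>2 = \<delta> * (u + 0)\<^sup>2 + \<gamma> * (w + \<beta> * u / \<gamma>)\<^sup>2"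
      using pos by (simp add: \<delta>_def power2_eq_square field_simps)
    then show ?thesis
      by (simp only: ennreal_mult'[symmetric] exp_ge_zero exp_add[symmetric])
        (simp add: add_divide_distrib diff_divide_distrib)
  qed
  have "emeasure (multivariate_normal R) (space (multivariate_normal R))
      = (\<integral>\<^sup>+z. (\<lambda>_. 1) (z $ i, z $ j) \<partial>multivariate_normal R)"
    by simp
  also have "\<dots> = c * (\<integral>\<^sup>+u. \<integral>\<^sup>+w. ennreal (exp (- (\<alpha> * u\<^sup>2 + 2 * \<beta> * u * w + \<gamma> * w\<^sup>2) / 2)) \<partial>lborel \<partial>lborel)"
    by (subst law, simp, subst lborel.nn_integral_fst[symmetric]) simp_all
  also have "\<dots> = c * (\<integral>\<^sup>+u. ennreal (exp (- (\<delta> * (u + 0)\<^sup>2) / 2)) * ennreal (sqrt (2 * pi / \<gamma>)) \<partial>lborel)"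
    unfolding split by (subst nn_integral_cmult) (simp_all only: nn_integral_exp_quadratic[OF pos(2)], measurable)
  also have "\<dots> = c * (ennreal (sqrt (2 * pi / \<delta>)) * ennreal (sqrt (2 * pi / \<gamma>)))"
    using pos(3) by (subst nn_integral_multc) (simp_all only: nn_integral_exp_quadratic \<delta>_def, measurable)
  also have "\<dots> < \<top>"
    using c by (simp add: ennreal_mult_less_top)
  finally show ?thesis by (intro finite_measureI) simp
qed


section \<open>Normal scores\<close>

interpretation std_normal: real_distribution std_normal_distribution
  by (rule real_dist_normal_dist)

lemma emeasure_density_lborel_singleton:
  fixes x :: real
  assumes [measurable]: "f \<in> borel_measurable borel"
  shows "emeasure (density lborel f) {x} = 0"
proof -
  have "{x} \<in> null_sets (density lborel f)"
  proof (intro null_sets_density_iff[THEN iffD2] conjI)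
    show "AE y in lborel. y \<in> {x} \<longrightarrow> f y = 0"
      using AE_lborel_singleton[of x] by eventually_elim simp
  qed simp_all
  then show ?thesis by (rule null_setsD1)
qed

text \<open>The c.d.f. may be constant on an interval, so \<open>m\<close> is the largest point of
  level \<open>u\<close>; only this choice makes the sublevel set the half-line
  \<open>{..m}\<close>. It exists by continuity and by the limits of the c.d.f. at both
  ends.\<close>

lemma cdf_level_set:
  assumes "real_distribution N" and cont: "\<And>x. isCont (cdf N) x" and u: "0 < u" "u < 1"
  obtains m where "cdf N m = u" "{x. cdf N x \<le> u} = {..m}"
proof -
  interpret N: real_distribution N by fact
  let ?S = "{x. cdf N x \<le> u}"
  obtain a where a: "cdf N a < u"
    using eventually_happens'[OF trivial_limit_at_bot_linorder order_tendstoD(2)[OF N.cdf_lim_at_bot u(1)]] by auto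
  obtain b where b: "u < cdf N b"
    using eventually_happens'[OF trivial_limit_at_top_linorder order_tendstoD(1)[OF N.cdf_lim_at_top_prob u(2)]] by auto
  have ub: "x \<le> b" if "x \<in> ?S" for x
    using that b N.cdf_nondecreasing[of b x] by force
  then have bdd: "bdd_above ?S" by (rule bdd_aboveI)
  have "closed ?S"
    using cont by (intro closed_Collect_le) (auto intro: continuous_at_imp_continuous_on)
  moreover have "?S \<noteq> {}" using less_imp_le[OF a] by blast
  ultimately have m: "Sup ?S \<in> ?S"
    using bdd by (intro closed_contains_Sup)
  have "Sup ?S \<le> b" by (rule ub[OF m])
  \<comment> \<open>The intermediate value theorem finds a point of level \<open>u\<close> to the
    right of the supremum. It lies in \<open>?S\<close>, so it is the supremum.\<close>
  then obtain c where c: "Sup ?S \<le> c" "cdf N c = u"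
    using IVT[of "cdf N" "Sup ?S" u b] m b cont by force
  then have "c \<le> Sup ?S" using bdd by (intro cSup_upper) auto
  with c have *: "cdf N (Sup ?S) = u" by simp
  moreover have "?S = {..Sup ?S}"
  proof (intro equalityI subsetI)
    fix x assume "x \<in> {..Sup ?S}"
    then have "cdf N x \<le> cdf N (Sup ?S)" by (simp add: N.cdf_nondecreasing)
    with m show "x \<in> ?S" by simp
  qed (use bdd in \<open>simp add: cSup_upper\<close>)
  ultimately show thesis by (rule that)
qed

section \<open>The standard normal c.d.f. and its inverse\<close>

lemma isCont_std_normal_cdf: "isCont std_normal_cdf x"
  unfolding std_normal_cdf_def std_normal.isCont_cdf
  by (simp add: measure_def emeasure_density_lborel_singleton)

text \<open>The normal density is positive everywhere, so an interval of zero normal mass would have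
  zero length.\<close>

lemma std_normal_cdf_strict_mono:
  assumes "x < y" shows "std_normal_cdf x < std_normal_cdf y"
proof (rule ccontr)
  assume "\<not> ?thesis"
  then have "measure std_normal_distribution {x<..y} = 0"
    using std_normal.cdf_diff_eq[OF assms] measure_nonneg[of std_normal_distribution "{x<..y}"]
    unfolding std_normal_cdf_def by linarith
  then have "{x<..y} \<in> null_sets std_normal_distribution"
    by (intro null_setsI) (simp_all add: std_normal.emeasure_eq_measure)
  then have "AE t in lborel. t \<in> {x<..y} \<longrightarrow> std_normal_density t = 0"
    by (simp add: null_sets_density_iff del: std_normal_density_def)
  then have "AE t in lborel. t \<notin> {x<..y}"
    by eventually_elim (metis normal_density_pos less_irrefl zero_less_one)
  then have "emeasure lborel {x<..y} = 0"
    by (intro null_setsD1 AE_iff_null_sets[THEN iffD2]) simp_all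
  then show False using assms by simp
qed

lemma std_normal_cdf_le_iff: "std_normal_cdf x \<le> std_normal_cdf y \<longleftrightarrow> x \<le> y"
  using std_normal_cdf_strict_mono by (metis not_le order.order_iff_strict)

lemma std_normal_cdf_bounds: "0 < std_normal_cdf x" "std_normal_cdf x < 1"
proof -
  have "0 \<le> std_normal_cdf (x - 1)" "std_normal_cdf (x + 1) \<le> 1"
    by (simp_all add: std_normal_cdf_def std_normal.cdf_nonneg std_normal.cdf_bounded_prob)
  then show "0 < std_normal_cdf x" "std_normal_cdf x < 1"
    using std_normal_cdf_strict_mono[of "x - 1" x] std_normal_cdf_strict_mono[of x "x + 1"] by auto
qed

lemma inv_std_normal_cdf: "inv std_normal_cdf (std_normal_cdf x) = x"
  by (rule inv_f_f) (metis injI std_normal_cdf_strict_mono less_irrefl neq_iff)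

lemma std_normal_cdf_inv:
  assumes "0 < u" "u < 1" shows "std_normal_cdf (inv std_normal_cdf u) = u"
proof -
  obtain m where "cdf std_normal_distribution m = u"
    by (rule cdf_level_set[OF real_dist_normal_dist isCont_std_normal_cdf[unfolded std_normal_cdf_def] assms])
  then show ?thesis
    by (intro f_inv_into_f) (auto simp: std_normal_cdf_def)
qed

lemma borel_measurable_inv_std_normal_cdf[measurable]: "inv std_normal_cdf \<in> borel_measurable borel"
proof -
  \<comment> \<open>Outside the open unit interval there is no preimage, so \<open>inv\<close>
    returns one and the same unspecified value there. Inside it is monotone, and the two pieces are
    glued.\<close>
  have *: "inv std_normal_cdf = (\<lambda>u. if u \<in> {0<..<1} then (inv std_normal_cdf) u else (SOME x. False))"
  proof
    fix u
    have "std_normal_cdf x \<noteq> u" if "u \<notin> {0<..<1}" for x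
      using std_normal_cdf_bounds[of x] that by auto
    then show "inv std_normal_cdf u = (if u \<in> {0<..<1} then inv std_normal_cdf u else (SOME x. False))"
      by (auto simp: inv_into_def)
  qed
  have "mono_on {0<..<1} (inv std_normal_cdf)"
    by (intro mono_onI, rule std_normal_cdf_le_iff[THEN iffD1]) (simp add: std_normal_cdf_inv)
  then have "inv std_normal_cdf \<in> borel_measurable (restrict_space borel {0<..<1})"
    by (rule borel_measurable_mono_on_fnc)
  then have "(\<lambda>u. if u \<in> {0<..<1} then (inv std_normal_cdf) u else (SOME x. False)) \<in> borel_measurable borel"
    by (intro measurable_If_restrict_space_iff[THEN iffD2]) (simp_all del: greaterThanLessThan_iff)
  then show ?thesis by (subst *)
qed

text \<open>The map behind \<open>transformed\<close>, with the law as an explicit argument and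
  acting on the real line, so that laws can be pushed forward along it and it can be
  inverted.\<close>

definition normal_score :: "real measure \<Rightarrow> real \<Rightarrow> real" where
  "normal_score N x = inv std_normal_cdf (cdf N x)"

lemma borel_measurable_cdf:
  assumes "real_distribution N" shows "cdf N \<in> borel_measurable borel"
proof -
  interpret N: real_distribution N by fact
  show ?thesis by (intro borel_measurable_mono monoI N.cdf_nondecreasing)
qed

lemma borel_measurable_normal_score:
  assumes "real_distribution N" shows "normal_score N \<in> borel_measurable borel"
  unfolding normal_score_def[abs_def]
  using borel_measurable_cdf[OF assms] by measurable

text \<open>The probability integral transform: a variable with continuous c.d.f. is uniform after
  applying that c.d.f.\<close>

lemma cdf_level_prob:
  assumes N: "real_distribution N" and cont: "\<And>x. isCont (cdf N) x" and u: "0 < u" "u < 1"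
  shows "measure N {x. cdf N x \<le> u} = u"
  by (rule cdf_level_set[OF N cont u]) (simp add: cdf_def2)

text \<open>Keeps the argument of \<open>inv std_normal_cdf\<close> almost surely inside the
  interval where it is a true inverse. The boundary values are reached as limits of the levels e and
  1 - e.\<close>

lemma AE_cdf_bounds:
  assumes N: "real_distribution N" and cont: "\<And>x. isCont (cdf N) x"
  shows "AE x in N. 0 < cdf N x \<and> cdf N x < 1"
proof -
  interpret N: real_distribution N by fact
  note [measurable] = borel_measurable_cdf[OF N]
  have "measure N {x. cdf N x \<le> 0} \<le> 0 + e" if "e > 0" for e
  proof -
    \<comment> \<open>The cut at 1/2 keeps the level strictly between 0 and 1, as
      \<open>cdf_level_prob\<close> demands.\<close>
    have "measure N {x. cdf N x \<le> 0} \<le> measure N {x. cdf N x \<le> min e (1/2)}"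
      using that by (intro N.finite_measure_mono) auto
    also have "\<dots> = min e (1/2)"
      using that by (intro cdf_level_prob[OF N cont]) auto
    finally show ?thesis by simp
  qed
  then have "measure N {x. cdf N x \<le> 0} = 0"
    by (intro antisym measure_nonneg) (rule field_le_epsilon)
  then have 0: "AE x in N. \<not> cdf N x \<le> 0"
    by (subst AE_iff_measurable[OF _ refl]) (auto simp: N.emeasure_eq_measure)
  have "1 \<le> measure N {x. cdf N x < 1} + e" if "e > 0" for e
  proof -
    have "1 - e \<le> max (1 - e) (1/2)" by simp
    also have "\<dots> = measure N {x. cdf N x \<le> max (1 - e) (1/2)}"
      using that by (intro cdf_level_prob[OF N cont, symmetric]) auto
    also have "\<dots> \<le> measure N {x. cdf N x < 1}"
      using that by (intro N.finite_measure_mono) auto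
    finally show ?thesis by simp
  qed
  then have "measure N {x. cdf N x < 1} = 1"
    by (intro antisym N.prob_le_1) (rule field_le_epsilon)
  then have "AE x in N. cdf N x < 1"
    using N.prob_Collect_eq_1[of "\<lambda>x. cdf N x < 1"] by simp
  with 0 show ?thesis by eventually_elim simp
qed

text \<open>A bound on the score becomes a bound on the feature itself, the form to which the copula
  hypothesis applies.\<close>

lemma normal_score_level:
  assumes N: "real_distribution N" and cont: "\<And>x. isCont (cdf N) x"
  obtains m where "cdf N m = std_normal_cdf z" "AE x in N. normal_score N x \<le> z \<longleftrightarrow> x \<le> m"
proof -
  obtain m where m: "cdf N m = std_normal_cdf z" "{x. cdf N x \<le> std_normal_cdf z} = {..m}"
    by (rule cdf_level_set[OF N cont std_normal_cdf_bounds[of z]])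
  have "AE x in N. normal_score N x \<le> z \<longleftrightarrow> x \<le> m"
    using AE_cdf_bounds[OF N cont]
  proof eventually_elim
    case (elim x)
    then have "normal_score N x \<le> z \<longleftrightarrow> cdf N x \<le> std_normal_cdf z"
      unfolding normal_score_def by (metis std_normal_cdf_inv std_normal_cdf_le_iff)
    then show ?case using m(2) by auto
  qed
  with m(1) show thesis by (rule that)
qed

lemma distr_normal_score:
  assumes N: "real_distribution N" and cont: "\<And>x. isCont (cdf N) x"
  shows "distr N borel (normal_score N) = std_normal_distribution"
proof (rule cdf_unique)
  interpret N: real_distribution N by fact
  note [measurable] = borel_measurable_normal_score[OF N]
  show "real_distribution (distr N borel (normal_score N))" by simp
  show "real_distribution std_normal_distribution" by (rule real_dist_normal_dist)
  show "cdf (distr N borel (normal_score N)) = cdf std_normal_distribution"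
  proof
    fix z
    obtain m where m: "cdf N m = std_normal_cdf z" "AE x in N. normal_score N x \<le> z \<longleftrightarrow> x \<le> m"
      by (rule normal_score_level[OF N cont])
    have "cdf (distr N borel (normal_score N)) z = measure N {x. normal_score N x \<le> z}"
      by (simp add: cdf_def measure_distr vimage_def)
    also have "\<dots> = measure N {x. x \<le> m}"
      using m(2) by (intro N.finite_measure_eq_AE) auto
    also have "\<dots> = std_normal_cdf z"
      by (simp add: m(1)[symmetric] cdf_def atMost_def)
    finally show "cdf (distr N borel (normal_score N)) z = cdf std_normal_distribution z"
      by (simp add: std_normal_cdf_def)
  qed
qed

text \<open>The left inverse is the quantile function of \<open>N\<close> composed with the standard normal c.d.f.\<close>

lemma normal_score_left_inverse:
  assumes N: "real_distribution N" and cont: "\<And>x. isCont (cdf N) x"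
  obtains \<psi> where "\<psi> \<in> borel_measurable borel" "AE x in N. \<psi> (normal_score N x) = x"
proof -
  interpret N: real_distribution N by fact
  interpret N: cdf_distribution N by standard
  note [measurable] = borel_measurable_cdf[OF N]
  define \<psi> where "\<psi> z = N.I (std_normal_cdf z)" for z
  have "mono \<psi>"
    unfolding \<psi>_def
    by (intro monoI mono_onD[OF N.mono_I]) (simp_all add: std_normal_cdf_bounds std_normal_cdf_le_iff)
  then have "\<psi> \<in> borel_measurable borel" by (rule borel_measurable_mono)
  \<comment> \<open>The quantile function fails to return \<open>x\<close> only if some rational
    \<open>q < x\<close> already has at least the level of \<open>x\<close>. For a fixed
    \<open>q\<close> such points form a null set, since the mass up to the level
    \<open>cdf N q\<close> equals the mass of \<open>{..q}\<close>. Countably many \<open>q\<close>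
    are enough.\<close>
  moreover have flat: "AE x in N. \<not> (q < x \<and> cdf N x \<le> cdf N q)" for q
  proof (cases "0 < cdf N q \<and> cdf N q < 1")
    case True
    have "measure N ({x. cdf N x \<le> cdf N q} - {..q}) = measure N {x. cdf N x \<le> cdf N q} - measure N {..q}"
      by (rule N.finite_measure_Diff) (auto intro: N.cdf_nondecreasing)
    also have "\<dots> = 0"
      using True cdf_level_prob[OF N cont, of "cdf N q"] by (simp add: cdf_def2[symmetric])
    also have "{x. cdf N x \<le> cdf N q} - {..q} = {x. q < x \<and> cdf N x \<le> cdf N q}" by auto
    finally have "measure N {x. q < x \<and> cdf N x \<le> cdf N q} = 0" .
    then show ?thesis
      by (subst AE_iff_measurable[OF _ refl]) (auto simp: N.emeasure_eq_measure)
  next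
    case False
    show ?thesis
    proof (cases "cdf N q \<le> 0")
      case True
      show ?thesis
        using AE_cdf_bounds[OF N cont] by eventually_elim (use True in linarith)
    next
      case False
      with \<open>\<not> (0 < cdf N q \<and> cdf N q < 1)\<close> have q: "cdf N q \<ge> 1" by simp
      show ?thesis
        using AE_cdf_bounds[OF N cont]
      proof eventually_elim
        case (elim x)
        have "cdf N q \<le> cdf N x" if "q < x" using that by (simp add: N.cdf_nondecreasing)
        with elim q show ?case by linarith
      qed
    qed
  qed
  have "AE x in N. \<forall>q\<in>\<rat>. \<not> (q < x \<and> cdf N x \<le> cdf N q)"
    by (rule AE_ball_countable[OF countable_rat, THEN iffD2]) (intro ballI flat)
  with AE_cdf_bounds[OF N cont] have "AE x in N. \<psi> (normal_score N x) = x"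
  proof eventually_elim
    case (elim x)
    have \<psi>: "\<psi> (normal_score N x) = N.I (cdf N x)"
      using elim by (simp add: \<psi>_def normal_score_def std_normal_cdf_inv)
    have le: "N.I (cdf N x) \<le> x"
      using elim N.pseudoinverse[of "cdf N x" x] by simp
    have "\<not> N.I (cdf N x) < x"
    proof
      assume "N.I (cdf N x) < x"
      then obtain q where q: "q \<in> \<rat>" "N.I (cdf N x) < q" "q < x"
        using Rats_dense_in_real by blast
      then have "cdf N x \<le> cdf N q"
        using elim N.pseudoinverse[of "cdf N x" q] by simp
      with q elim show False by blast
    qed
    with le \<psi> show ?case by simp
  qed
  ultimately show thesis by (intro that)
qed


section \<open>The joint law of two normal scores\<close>

lemma distributedI_nn_integral:
  assumes [measurable]: "X \<in> measurable M N" "f \<in> borel_measurable N"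
    and eq: "\<And>h. h \<in> borel_measurable N \<Longrightarrow> (\<integral>\<^sup>+\<omega>. h (X \<omega>) \<partial>M) = (\<integral>\<^sup>+x. f x * h x \<partial>N)"
  shows "distributed M N X f"
  unfolding distributed_def
proof (intro conjI measure_eqI)
  fix A assume "A \<in> sets (distr M N X)"
  then have [measurable]: "A \<in> sets N" by simp
  have "emeasure (distr M N X) A = (\<integral>\<^sup>+\<omega>. indicator A (X \<omega>) \<partial>M)"
    by (subst nn_integral_distr[symmetric, of X M N]) simp_all
  also have "\<dots> = emeasure (density N f) A"
    by (simp add: eq emeasure_density)
  finally show "emeasure (distr M N X) A = emeasure (density N f) A" .
qed simp_all

text \<open>Turns an identity that holds almost everywhere into one at a concrete point of any
  chosen interval.\<close>

lemma AE_lborel_Ioo_ex: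
  assumes "AE u in lborel. Q u" "a < (b::real)"
  shows "\<exists>u. a < u \<and> u < b \<and> Q u"
proof (rule ccontr)
  assume "\<not> ?thesis"
  with assms(1) have "AE u in lborel. u \<notin> {a<..<b}"
    by (auto elim!: eventually_mono)
  then have "{a<..<b} \<in> null_sets lborel"
    by (subst AE_iff_null_sets) simp_all
  then have "emeasure lborel {a<..<b} = 0" by (rule null_setsD1)
  then show False using assms(2) by simp
qed

section \<open>Identifying a Gaussian pair from its marginals\<close>

lemma exp_half_add: "exp (- (x + y) / 2) = exp (- x / 2) * exp (- y / 2 :: real)"
  by (simp add: exp_add[symmetric] diff_divide_distrib)

text \<open>Integrating out \<open>w\<close> leaves a multiple of exp(-\<delta> u^2/2), where
  \<delta> is the Schur complement. Densities are unique almost everywhere, so this must be the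
  standard normal density, which fixes first \<delta> and then \<open>c\<close>.\<close>

lemma (in prob_space) gaussian_marginal_normalization:
  fixes c :: ennreal and \<alpha> \<beta> \<gamma> :: real
  assumes U: "distributed M lborel U std_normal_density"
    and c: "c < \<top>" and pos: "\<gamma> > 0"
    and law: "\<And>h. h \<in> borel_measurable borel \<Longrightarrow> (\<integral>\<^sup>+\<omega>. h (U \<omega>) \<partial>M) =
      c * (\<integral>\<^sup>+u. \<integral>\<^sup>+w. h u * ennreal (exp (- (\<alpha> * u\<^sup>2 + 2 * \<beta> * u * w + \<gamma> * w\<^sup>2) / 2)) \<partial>lborel \<partial>lborel)"
  shows "\<alpha> - \<beta>\<^sup>2 / \<gamma> = 1" "c = ennreal (sqrt \<gamma> / (2 * pi))"
proof -
  have [measurable]: "U \<in> borel_measurable M"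
    using distributed_measurable[OF U] by simp
  obtain c' where c': "c = ennreal c'" "c' \<ge> 0"
    using c by (cases c) auto
  define \<delta> where "\<delta> = \<alpha> - \<beta>\<^sup>2 / \<gamma>"
  define k where "k = c' * sqrt (2 * pi / \<gamma>)"
  have k0: "k \<ge> 0" using c' pos by (simp add: k_def)
  have "distributed M lborel U (\<lambda>u. ennreal (k * exp (- (\<delta> * u\<^sup>2) / 2)))"
  proof (rule distributedI_nn_integral)
    fix h :: "real \<Rightarrow> ennreal" assume h: "h \<in> borel_measurable lborel"
    then have [measurable]: "h \<in> borel_measurable borel" by simp
    have sq: "\<alpha> * u\<^sup>2 + 2 * \<beta> * u * w + \<gamma> * w\<^sup>2 = \<delta> * u\<^sup>2 + \<gamma> * (w + \<beta> * u / \<gamma>)\<^sup>2" for u w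
      using pos by (simp add: \<delta>_def power2_eq_square field_simps)
    have split: "h u * ennreal (exp (- (\<alpha> * u\<^sup>2 + 2 * \<beta> * u * w + \<gamma> * w\<^sup>2) / 2))
        = (h u * ennreal (exp (- (\<delta> * u\<^sup>2) / 2))) * ennreal (exp (- (\<gamma> * (w + \<beta> * u / \<gamma>)\<^sup>2) / 2))" for u w
      unfolding sq exp_half_add by (simp only: ennreal_mult' exp_ge_zero mult.assoc)
    have "(\<integral>\<^sup>+\<omega>. h (U \<omega>) \<partial>M)
        = c * (\<integral>\<^sup>+u. h u * ennreal (exp (- (\<delta> * u\<^sup>2) / 2)) * ennreal (sqrt (2 * pi / \<gamma>)) \<partial>lborel)"
      unfolding law[OF \<open>h \<in> borel_measurable borel\<close>] split
      by (subst nn_integral_cmult) (simp_all only: nn_integral_exp_quadratic[OF pos], measurable)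
    also have "\<dots> = (\<integral>\<^sup>+u. c * (h u * ennreal (exp (- (\<delta> * u\<^sup>2) / 2)) * ennreal (sqrt (2 * pi / \<gamma>))) \<partial>lborel)"
      by (rule nn_integral_cmult[symmetric]) simp
    also have "\<dots> = (\<integral>\<^sup>+u. ennreal (k * exp (- (\<delta> * u\<^sup>2) / 2)) * h u \<partial>lborel)"
      using c' pos by (intro nn_integral_cong) (simp add: k_def ennreal_mult mult_ac)
    finally show "(\<integral>\<^sup>+\<omega>. h (U \<omega>) \<partial>M) = (\<integral>\<^sup>+u. ennreal (k * exp (- (\<delta> * u\<^sup>2) / 2)) * h u \<partial>lborel)" .
  qed simp_all
  from distributed_unique[OF this U]
  have "AE u in lborel. ennreal (k * exp (- (\<delta> * u\<^sup>2) / 2)) = ennreal (std_normal_density u)" .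
  then have ae: "AE u in lborel. k * exp (- (\<delta> * u\<^sup>2) / 2) = exp (- u\<^sup>2 / 2) / sqrt (2 * pi)"
    by (rule eventually_mono) (use k0 in \<open>simp add: std_normal_density_def\<close>)
  \<comment> \<open>Two points with different squares suffice: \<open>k * sqrt (2 * pi)\<close>
    equals exp((\<delta> - 1) t^2/2) at both of them, so \<delta> = 1.\<close>
  obtain u v where u: "0 < u" "u < 1" "k * exp (- (\<delta> * u\<^sup>2) / 2) = exp (- u\<^sup>2 / 2) / sqrt (2 * pi)"
    and v: "1 < v" "v < 2" "k * exp (- (\<delta> * v\<^sup>2) / 2) = exp (- v\<^sup>2 / 2) / sqrt (2 * pi)"
    using AE_lborel_Ioo_ex[OF ae, of 0 1] AE_lborel_Ioo_ex[OF ae, of 1 2] by auto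
  have exp_form: "k * sqrt (2 * pi) = exp ((\<delta> - 1) * t\<^sup>2 / 2)"
    if "k * exp (- (\<delta> * t\<^sup>2) / 2) = exp (- t\<^sup>2 / 2) / sqrt (2 * pi)" for t
  proof -
    have "k * sqrt (2 * pi) = (k * exp (- (\<delta> * t\<^sup>2) / 2)) * sqrt (2 * pi) * exp (\<delta> * t\<^sup>2 / 2)"
      by (simp add: exp_minus)
    also have "\<dots> = exp (- t\<^sup>2 / 2) * exp (\<delta> * t\<^sup>2 / 2)"
      unfolding that by simp
    also have "\<dots> = exp ((\<delta> - 1) * t\<^sup>2 / 2)"
      by (simp add: exp_add[symmetric] algebra_simps diff_divide_distrib)
    finally show ?thesis .
  qed
  have "(\<delta> - 1) * u\<^sup>2 / 2 = (\<delta> - 1) * v\<^sup>2 / 2"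
    using exp_form[OF u(3)] exp_form[OF v(3)] by (metis exp_inj_iff)
  then have "(\<delta> - 1) * (v\<^sup>2 - u\<^sup>2) = 0" by (simp only: right_diff_distrib)
  moreover have "u\<^sup>2 < v\<^sup>2"
    using u v by (intro power_strict_mono) auto
  ultimately have \<delta>: "\<delta> = 1" by (metis diff_gt_0_iff_gt eq_iff_diff_eq_0 less_irrefl mult_eq_0_iff)
  then show "\<alpha> - \<beta>\<^sup>2 / \<gamma> = 1" by (simp add: \<delta>_def)
  have "c' * (sqrt (2 * pi / \<gamma>) * sqrt (2 * pi)) = 1"
    using exp_form[OF u(3)] \<delta> by (simp add: k_def)
  moreover have sq: "sqrt (2 * pi / \<gamma>) * sqrt (2 * pi) = 2 * pi / sqrt \<gamma>"
    by (simp add: real_sqrt_divide)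
  ultimately have "c' * (2 * pi / sqrt \<gamma>) = 1"
    by (simp only: sq)
  then have "c' = sqrt \<gamma> / (2 * pi)"
    using pos by (simp add: field_simps)
  then show "c = ennreal (sqrt \<gamma> / (2 * pi))" using c' by simp
qed

text \<open>The bivariate normal density with correlation \<open>\<rho>\<close>, factored into the
  conditional density of the first coordinate given the second and the density of the second. In
  this form the inner integrals are one-dimensional normal moments.\<close>

definition gauss_pair_density :: "real \<Rightarrow> real \<times> real \<Rightarrow> real" where
  "gauss_pair_density \<rho> p =
     normal_density (\<rho> * snd p) (sqrt (1 - \<rho>\<^sup>2)) (fst p) * std_normal_density (snd p)"

lemma borel_measurable_gauss_pair_density[measurable]:
  "gauss_pair_density \<rho> \<in> borel_measurable (borel \<Otimes>\<^sub>M borel)"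
  unfolding gauss_pair_density_def[abs_def] normal_density_def by measurable

lemma gauss_pair_density_nonneg[simp]: "0 \<le> gauss_pair_density \<rho> p"
  by (simp add: gauss_pair_density_def)

text \<open>Normalizing each coordinate gives \<alpha> - \<beta>^2/\<gamma> = 1 and \<gamma> -
  \<beta>^2/\<alpha> = 1. Clearing denominators yields \<alpha> = \<gamma>, so a single parameter is
  left.\<close>

lemma (in prob_space) gaussian_pair_std_normal:
  fixes c :: ennreal and \<alpha> \<beta> \<gamma> :: real
  assumes U: "distributed M lborel U std_normal_density"
    and W: "distributed M lborel W std_normal_density"
    and c: "c < \<top>" and pos: "\<alpha> > 0" "\<gamma> > 0"
    and law: "\<And>h. h \<in> borel_measurable (lborel \<Otimes>\<^sub>M lborel) \<Longrightarrow> (\<integral>\<^sup>+\<omega>. h (U \<omega>, W \<omega>) \<partial>M) =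
      c * (\<integral>\<^sup>+p. h p * ennreal (exp (- (\<alpha> * (fst p)\<^sup>2 + 2 * \<beta> * fst p * snd p + \<gamma> * (snd p)\<^sup>2) / 2))
        \<partial>(lborel \<Otimes>\<^sub>M lborel))"
  obtains \<rho> where "\<rho>\<^sup>2 < 1"
    "distributed M (lborel \<Otimes>\<^sub>M lborel) (\<lambda>\<omega>. (U \<omega>, W \<omega>)) (gauss_pair_density \<rho>)"
proof -
  have [measurable]: "U \<in> borel_measurable M" "W \<in> borel_measurable M"
    using distributed_measurable[OF U] distributed_measurable[OF W] by simp_all
  have lawU: "(\<integral>\<^sup>+\<omega>. h (U \<omega>) \<partial>M) =
      c * (\<integral>\<^sup>+u. \<integral>\<^sup>+w. h u * ennreal (exp (- (\<alpha> * u\<^sup>2 + 2 * \<beta> * u * w + \<gamma> * w\<^sup>2) / 2)) \<partial>lborel \<partial>lborel)"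
    if [measurable]: "h \<in> borel_measurable borel" for h
  proof -
    have "(\<integral>\<^sup>+\<omega>. h (U \<omega>) \<partial>M) = c * (\<integral>\<^sup>+p. h (fst p) *
        ennreal (exp (- (\<alpha> * (fst p)\<^sup>2 + 2 * \<beta> * fst p * snd p + \<gamma> * (snd p)\<^sup>2) / 2)) \<partial>(lborel \<Otimes>\<^sub>M lborel))"
      using law[of "\<lambda>p. h (fst p)"] by simp
    then show ?thesis
      by (subst (asm) lborel.nn_integral_fst[symmetric]) simp_all
  qed
  have lawW: "(\<integral>\<^sup>+\<omega>. h (W \<omega>) \<partial>M) =
      c * (\<integral>\<^sup>+w. \<integral>\<^sup>+u. h w * ennreal (exp (- (\<gamma> * w\<^sup>2 + 2 * \<beta> * w * u + \<alpha> * u\<^sup>2) / 2)) \<partial>lborel \<partial>lborel)"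
    if [measurable]: "h \<in> borel_measurable borel" for h
  proof -
    have eq: "\<alpha> * u\<^sup>2 + 2 * \<beta> * u * w + \<gamma> * w\<^sup>2 = \<gamma> * w\<^sup>2 + 2 * \<beta> * w * u + \<alpha> * u\<^sup>2" for u w
      by simp
    have "(\<integral>\<^sup>+\<omega>. h (W \<omega>) \<partial>M) = c * (\<integral>\<^sup>+p. h (snd p) *
        ennreal (exp (- (\<gamma> * (snd p)\<^sup>2 + 2 * \<beta> * snd p * fst p + \<alpha> * (fst p)\<^sup>2) / 2)) \<partial>(lborel \<Otimes>\<^sub>M lborel))"
      using law[of "\<lambda>p. h (snd p)"] unfolding eq by simp
    then show ?thesis
      by (subst (asm) lborel_pair.nn_integral_snd[symmetric]) simp_all
  qed
  have 1: "\<alpha> - \<beta>\<^sup>2 / \<gamma> = 1" "c = ennreal (sqrt \<gamma> / (2 * pi))"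
    by (rule gaussian_marginal_normalization[OF U c pos(2)], erule lawU)+
  have 2: "\<gamma> - \<beta>\<^sup>2 / \<alpha> = 1"
    by (rule gaussian_marginal_normalization[OF W c pos(1)], erule lawW)
  have "\<alpha> * \<gamma> - \<beta>\<^sup>2 = \<gamma>" "\<alpha> * \<gamma> - \<beta>\<^sup>2 = \<alpha>"
    using 1(1) 2 pos by (simp_all add: field_simps)
  then have eq: "\<gamma> = \<alpha>" and det: "\<alpha> * \<alpha> - \<beta>\<^sup>2 = \<alpha>" by auto
  \<comment> \<open>In the bivariate normal exponent \<alpha> is 1/(1 - \<rho>^2) and \<beta> is
    -\<rho>/(1 - \<rho>^2), so this quotient recovers the correlation.\<close>
  define \<rho> where "\<rho> = - \<beta> / \<alpha>"
  have \<beta>: "\<beta> = - \<rho> * \<alpha>" using pos by (simp add: \<rho>_def)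
  have "\<alpha> * (\<alpha> * (1 - \<rho>\<^sup>2)) = \<alpha> * 1"
    using det by (simp add: \<beta> power2_eq_square algebra_simps)
  then have \<alpha>: "\<alpha> * (1 - \<rho>\<^sup>2) = 1" using pos by simp
  then have \<rho>: "1 - \<rho>\<^sup>2 > 0" using pos by (metis zero_less_mult_pos zero_less_one)
  have \<alpha>': "\<alpha> = 1 / (1 - \<rho>\<^sup>2)" using \<alpha> \<rho> by (simp add: field_simps)
  have dens: "sqrt \<gamma> / (2 * pi) * exp (- (\<alpha> * u\<^sup>2 + 2 * \<beta> * u * w + \<gamma> * w\<^sup>2) / 2)
      = gauss_pair_density \<rho> (u, w)" for u w
  proof -
    have "\<alpha> * u\<^sup>2 + 2 * \<beta> * u * w + \<gamma> * w\<^sup>2 = \<alpha> * (u - \<rho> * w)\<^sup>2 + \<alpha> * (1 - \<rho>\<^sup>2) * w\<^sup>2"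
      by (simp add: eq \<beta> power2_eq_square algebra_simps)
    then have q: "\<alpha> * u\<^sup>2 + 2 * \<beta> * u * w + \<gamma> * w\<^sup>2 = \<alpha> * (u - \<rho> * w)\<^sup>2 + w\<^sup>2"
      by (simp only: \<alpha> mult_1)
    have "- (\<alpha> * (u - \<rho> * w)\<^sup>2) / 2 = - (u - \<rho> * w)\<^sup>2 / (2 * (1 - \<rho>\<^sup>2))"
      by (simp add: \<alpha>')
    then have "exp (- (\<alpha> * u\<^sup>2 + 2 * \<beta> * u * w + \<gamma> * w\<^sup>2) / 2)
        = exp (- (u - \<rho> * w)\<^sup>2 / (2 * (1 - \<rho>\<^sup>2))) * exp (- w\<^sup>2 / 2)"
      unfolding q exp_half_add by (simp only:)
    moreover have "sqrt \<gamma> / (2 * pi) = 1 / sqrt (2 * pi * (1 - \<rho>\<^sup>2)) * (1 / sqrt (2 * pi))"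
      using real_sqrt_mult[of "2 * pi" "1 - \<rho>\<^sup>2"] by (simp add: eq \<alpha>' real_sqrt_divide)
    ultimately show ?thesis
      using \<rho> by (simp add: gauss_pair_density_def normal_density_def)
  qed
  have "distributed M (lborel \<Otimes>\<^sub>M lborel) (\<lambda>\<omega>. (U \<omega>, W \<omega>)) (gauss_pair_density \<rho>)"
  proof (rule distributedI_nn_integral)
    fix h :: "real \<times> real \<Rightarrow> ennreal" assume h[measurable]: "h \<in> borel_measurable (lborel \<Otimes>\<^sub>M lborel)"
    show "(\<integral>\<^sup>+\<omega>. h (U \<omega>, W \<omega>) \<partial>M) = (\<integral>\<^sup>+p. ennreal (gauss_pair_density \<rho> p) * h p \<partial>(lborel \<Otimes>\<^sub>M lborel))"
    proof -
      have "c * ennreal (exp (- (\<alpha> * (fst p)\<^sup>2 + 2 * \<beta> * fst p * snd p + \<gamma> * (snd p)\<^sup>2) / 2))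
        = ennreal (gauss_pair_density \<rho> p)" for p
      proof -
        have "c * ennreal (exp (- (\<alpha> * (fst p)\<^sup>2 + 2 * \<beta> * fst p * snd p + \<gamma> * (snd p)\<^sup>2) / 2))
          = ennreal (sqrt \<gamma> / (2 * pi) * exp (- (\<alpha> * (fst p)\<^sup>2 + 2 * \<beta> * fst p * snd p + \<gamma> * (snd p)\<^sup>2) / 2))"
          by (subst 1(2), rule ennreal_mult''[symmetric]) simp
        then show ?thesis unfolding dens by simp
      qed
      then have eq: "c * (h p * ennreal (exp (- (\<alpha> * (fst p)\<^sup>2 + 2 * \<beta> * fst p * snd p + \<gamma> * (snd p)\<^sup>2) / 2)))
        = ennreal (gauss_pair_density \<rho> p) * h p" for p
        by (metis mult.assoc mult.commute)
      show ?thesis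
        unfolding law[OF h] eq[symmetric] by (rule nn_integral_cmult[symmetric]) simp
    qed
  qed simp_all
  moreover have "\<rho>\<^sup>2 < 1" using \<rho> by simp
  ultimately show thesis by (rule that[rotated])
qed

section \<open>Moments and correlation of the pair\<close>

lemma (in prob_space) std_normal_moments:
  assumes U: "distributed M lborel U std_normal_density"
  shows "integrable M U" "expectation U = 0" "integrable M (\<lambda>\<omega>. (U \<omega>)\<^sup>2)" "expectation (\<lambda>\<omega>. (U \<omega>)\<^sup>2) = 1"
proof -
  show "integrable M U"
    using distributed_integrable[OF U, of "\<lambda>x. x"] integrable_std_normal_moment[of 1] by simp
  show "integrable M (\<lambda>\<omega>. (U \<omega>)\<^sup>2)"
    using distributed_integrable[OF U, of "\<lambda>x. x\<^sup>2"] integrable_std_normal_moment[of 2] by simp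
  show "expectation U = 0"
    by (rule standard_normal_distributed_expectation[OF U])
  show "expectation (\<lambda>\<omega>. (U \<omega>)\<^sup>2) = 1"
    using distributed_integral[OF U, of "\<lambda>x. x\<^sup>2"] integral_std_normal_moment_even[of 1] by simp
qed

lemma (in prob_space) gauss_pair_product_moment:
  assumes U: "distributed M lborel U std_normal_density"
    and W: "distributed M lborel W std_normal_density"
    and \<rho>: "\<rho>\<^sup>2 < 1"
    and UW: "distributed M (lborel \<Otimes>\<^sub>M lborel) (\<lambda>\<omega>. (U \<omega>, W \<omega>)) (gauss_pair_density \<rho>)"
  shows "integrable M (\<lambda>\<omega>. U \<omega> * W \<omega>)" "expectation (\<lambda>\<omega>. U \<omega> * W \<omega>) = \<rho>"
proof -
  have [measurable]: "U \<in> borel_measurable M" "W \<in> borel_measurable M"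
    using distributed_measurable[OF U] distributed_measurable[OF W] by simp_all
  have bound: "norm (U \<omega> * W \<omega>) \<le> norm ((U \<omega>)\<^sup>2 + (W \<omega>)\<^sup>2)" for \<omega>
  proof -
    have "2 * \<bar>U \<omega> * W \<omega>\<bar> \<le> (U \<omega>)\<^sup>2 + (W \<omega>)\<^sup>2"
      using sum_squares_bound[of "\<bar>U \<omega>\<bar>" "\<bar>W \<omega>\<bar>"] by (simp add: abs_mult)
    then show ?thesis by simp
  qed
  show int: "integrable M (\<lambda>\<omega>. U \<omega> * W \<omega>)"
    by (rule Bochner_Integration.integrable_bound[OF Bochner_Integration.integrable_add
        [OF std_normal_moments(3)[OF U] std_normal_moments(3)[OF W]]]) (simp, rule AE_I2, rule bound)
  have [measurable]: "(\<lambda>p. fst p * snd p) \<in> borel_measurable (lborel \<Otimes>\<^sub>M lborel :: (real \<times> real) measure)"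
    by simp
  have "integrable (lborel \<Otimes>\<^sub>M lborel) (\<lambda>p. gauss_pair_density \<rho> p * (fst p * snd p))"
    using int by (subst distributed_integrable[OF UW]) simp_all
  then have int2: "integrable (lborel \<Otimes>\<^sub>M lborel) (\<lambda>(u, w). gauss_pair_density \<rho> (u, w) * (u * w))"
    by (simp add: case_prod_beta')
  have "expectation (\<lambda>\<omega>. U \<omega> * W \<omega>)
      = (\<integral>p. gauss_pair_density \<rho> p * (fst p * snd p) \<partial>(lborel \<Otimes>\<^sub>M lborel))"
    by (subst distributed_integral[OF UW]) simp_all
  also have "\<dots> = (\<integral>w. \<integral>u. gauss_pair_density \<rho> (u, w) * (u * w) \<partial>lborel \<partial>lborel)"
    using lborel_pair.integral_snd[OF int2] by (simp add: case_prod_beta')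
  \<comment> \<open>For fixed \<open>w\<close> the first coordinate has conditional mean
    \<open>\<rho> * w\<close>; what is left is \<rho> times a second moment.\<close>
  also have "\<dots> = (\<integral>w. \<rho> * (std_normal_density w * w\<^sup>2) \<partial>lborel)"
  proof (rule Bochner_Integration.integral_cong[OF refl])
    fix w
    have "(\<integral>u. gauss_pair_density \<rho> (u, w) * (u * w) \<partial>lborel)
        = (\<integral>u. (std_normal_density w * w) * (normal_density (\<rho> * w) (sqrt (1 - \<rho>\<^sup>2)) u * u) \<partial>lborel)"
      by (simp add: gauss_pair_density_def mult_ac)
    also have "\<dots> = (std_normal_density w * w) * (\<rho> * w)"
      using \<rho> by (subst integral_mult_right_zero, subst integral_normal_moment_nz_1) simp_all
    finally show "(\<integral>u. gauss_pair_density \<rho> (u, w) * (u * w) \<partial>lborel) = \<rho> * (std_normal_density w * w\<^sup>2)"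
      by (simp add: power2_eq_square)
  qed
  also have "\<dots> = \<rho>"
    using integral_std_normal_moment_even[of 1] by simp
  finally show "expectation (\<lambda>\<omega>. U \<omega> * W \<omega>) = \<rho>" .
qed

lemma (in prob_space) correlation_gauss_pair:
  assumes U: "distributed M lborel U std_normal_density"
    and W: "distributed M lborel W std_normal_density"
    and \<rho>: "\<rho>\<^sup>2 < 1"
    and UW: "distributed M (lborel \<Otimes>\<^sub>M lborel) (\<lambda>\<omega>. (U \<omega>, W \<omega>)) (gauss_pair_density \<rho>)"
  shows "correlation M U W = \<rho>"
  unfolding correlation_def
  by (simp add: std_normal_moments[OF U] std_normal_moments[OF W] gauss_pair_product_moment[OF assms])

text \<open>Both sides are the expectation of \<open>k\<close> at the score. This is the
  substitution between score and feature, carried out through laws and hence valid where the c.d.f.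
  is flat.\<close>

lemma nn_integral_normal_score:
  assumes f: "distributed M lborel X f" and M: "prob_space M"
    and cont: "\<And>x. isCont (cdf (distr M borel X)) x"
    and k: "k \<in> borel_measurable borel"
  shows "(\<integral>\<^sup>+u. ennreal (std_normal_density u) * k u \<partial>lborel)
    = (\<integral>\<^sup>+x. f x * k (normal_score (distr M borel X) x) \<partial>lborel)"
proof -
  let ?N = "distr M borel X"
  note [measurable] = k distributed_borel_measurable[OF f]
  have [measurable]: "X \<in> borel_measurable M" using distributed_measurable[OF f] by simp
  have N: "real_distribution ?N"
    using M by (rule prob_space.real_distribution_distr) simp
  note [measurable] = borel_measurable_normal_score[OF N]
  have N_eq: "density lborel f = ?N"
    using distributed_distr_eq_density[OF f] by (simp cong: distr_cong)
  have "(\<integral>\<^sup>+x. f x * k (normal_score ?N x) \<partial>lborel) = (\<integral>\<^sup>+x. k (normal_score ?N x) \<partial>density lborel f)"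
    by (rule nn_integral_density[symmetric]) simp_all
  also have "\<dots> = (\<integral>\<^sup>+x. k (normal_score ?N x) \<partial>?N)"
    by (simp only: N_eq)
  also have "\<dots> = (\<integral>\<^sup>+u. k u \<partial>distr ?N borel (normal_score ?N))"
    by (rule nn_integral_distr[symmetric]) simp_all
  also have "\<dots> = (\<integral>\<^sup>+u. ennreal (std_normal_density u) * k u \<partial>lborel)"
    unfolding distr_normal_score[OF N cont] by (rule nn_integral_density) simp_all
  finally show ?thesis ..
qed

lemma distributed_normal_score:
  assumes f: "distributed M lborel X f" and M: "prob_space M"
    and cont: "\<And>x. isCont (cdf (distr M borel X)) x"
  shows "distributed M lborel (\<lambda>\<omega>. normal_score (distr M borel X) (X \<omega>)) std_normal_density"
proof (rule distributedI_nn_integral)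
  let ?N = "distr M borel X"
  have [measurable]: "X \<in> borel_measurable M" using distributed_measurable[OF f] by simp
  have N: "real_distribution ?N"
    using M by (rule prob_space.real_distribution_distr) simp
  note [measurable] = borel_measurable_normal_score[OF N]
  show "(\<lambda>\<omega>. normal_score ?N (X \<omega>)) \<in> M \<rightarrow>\<^sub>M lborel" by simp
  fix h :: "real \<Rightarrow> ennreal" assume "h \<in> borel_measurable lborel"
  then have [measurable]: "h \<in> borel_measurable borel" by simp
  show "(\<integral>\<^sup>+\<omega>. h (normal_score ?N (X \<omega>)) \<partial>M) = (\<integral>\<^sup>+x. ennreal (std_normal_density x) * h x \<partial>lborel)"
    by (subst nn_integral_normal_score[OF f M cont]) (simp_all add: distributed_nn_integral[OF f])
qed simp

lemma isCont_cdf_distributed: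
  assumes f: "distributed M lborel X f" and M: "prob_space M"
  shows "isCont (cdf (distr M borel X)) x"
proof -
  have [measurable]: "X \<in> borel_measurable M" using distributed_measurable[OF f] by simp
  interpret N: real_distribution "distr M borel X"
    using M by (rule prob_space.real_distribution_distr) simp
  have "distr M borel X = density lborel f"
    using distributed_distr_eq_density[OF f] by (simp cong: distr_cong)
  then show ?thesis
    using distributed_borel_measurable[OF f]
    unfolding N.isCont_cdf by (simp add: measure_def emeasure_density_lborel_singleton)
qed

text \<open>The orthants \<open>{..z}\<close> are stable under intersection and generate the Borel
  sets, so it suffices to compare both measures on them. There Sklar's relation applies once bounds
  on scores are traded for bounds on features.\<close>

lemma normal_scores_multivariate_normal:
  fixes X :: "'n::finite \<Rightarrow> 'a \<Rightarrow> real"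
  assumes P: "prob_space P" and X: "\<And>i. X i \<in> borel_measurable P"
    and cont: "\<And>i x. isCont (cdf (distr P borel (X i))) x"
    and cop: "has_gauss_copula P X R" and fin: "finite_measure (multivariate_normal R)"
  shows "distr P borel (\<lambda>\<omega>. \<chi> i. normal_score (distr P borel (X i)) (X i \<omega>)) = multivariate_normal R"
proof -
  interpret P: prob_space P by fact
  interpret R: finite_measure "multivariate_normal R" by fact
  note [measurable] = X
  have N: "real_distribution (distr P borel (X i))" for i by simp
  note [measurable] = borel_measurable_normal_score[OF N]
  let ?Z = "\<lambda>\<omega>. \<chi> i. normal_score (distr P borel (X i)) (X i \<omega>)"
  have Z[measurable]: "?Z \<in> borel_measurable P"
    by (subst borel_measurable_euclidean_space) (auto simp: Basis_vec_def inner_axis)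
  have setsR: "sets (multivariate_normal R) = sets borel" "space (multivariate_normal R) = UNIV"
    by (simp_all add: multivariate_normal_def)
  have orthant: "emeasure (distr P borel ?Z) {..z} = emeasure (multivariate_normal R) {..z}" for z
  proof -
    have "\<exists>m. cdf (distr P borel (X i)) m = std_normal_cdf (z $ i) \<and>
      (AE x in distr P borel (X i). normal_score (distr P borel (X i)) x \<le> z $ i \<longleftrightarrow> x \<le> m)" for i
      using normal_score_level[OF N cont, of i "z $ i"] by blast
    then obtain m where m: "\<And>i. cdf (distr P borel (X i)) (m i) = std_normal_cdf (z $ i)"
      and ae: "\<And>i. AE x in distr P borel (X i). normal_score (distr P borel (X i)) x \<le> z $ i \<longleftrightarrow> x \<le> m i"
      by metis
    have "AE \<omega> in P. \<forall>i. normal_score (distr P borel (X i)) (X i \<omega>) \<le> z $ i \<longleftrightarrow> X i \<omega> \<le> m i"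
      by (subst AE_all_countable) (intro allI AE_distrD[OF X ae])
    then have eq: "measure P {\<omega> \<in> space P. \<forall>i. normal_score (distr P borel (X i)) (X i \<omega>) \<le> z $ i}
      = measure P {\<omega> \<in> space P. \<forall>i. X i \<omega> \<le> m i}"
      by (intro P.finite_measure_eq_AE) auto
    have "emeasure (distr P borel ?Z) {..z} = measure P (?Z -` {..z} \<inter> space P)"
      by (simp add: emeasure_distr P.emeasure_eq_measure)
    also have "?Z -` {..z} \<inter> space P = {\<omega> \<in> space P. \<forall>i. normal_score (distr P borel (X i)) (X i \<omega>) \<le> z $ i}"
      by (auto simp: less_eq_vec_def)
    \<comment> \<open>Each marginal value at \<open>m i\<close> is a value of the normal c.d.f.,
      hence strictly between 0 and 1, where \<open>has_gauss_copula\<close> makes its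
      assertion.\<close>
    also have "measure P \<dots> = gauss_copula R (\<lambda>i. cdf (distr P borel (X i)) (m i))"
      unfolding eq using cop m std_normal_cdf_bounds by (simp add: has_gauss_copula_def)
    also have "\<dots> = measure (multivariate_normal R) {..z}"
      by (simp add: gauss_copula_def m inv_std_normal_cdf less_eq_vec_def atMost_def)
    finally show ?thesis by (simp add: R.emeasure_eq_measure)
  qed
  show ?thesis
  proof (rule measure_eqI_generator_eq[where E="range atMost" and \<Omega>=UNIV and A="\<lambda>k::nat. {..(\<chi> i. real k)}"])
    show "Int_stable (range atMost :: (real^'n) set set)"
    proof (rule Int_stableI_image)
      fix a b :: "real^'n"
      have "{..a} \<inter> {..b} = {..(\<chi> i. min (a $ i) (b $ i))}"
        by (auto simp: less_eq_vec_def)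
      then show "\<exists>c\<in>UNIV. {..a} \<inter> {..b} = {..c}" by blast
    qed
    show "sets (distr P borel ?Z) = sigma_sets UNIV (range atMost)"
      "sets (multivariate_normal R) = sigma_sets UNIV (range atMost)"
      unfolding setsR by (simp_all add: borel_eq_atMost)
    show "(\<Union>k::nat. {..(\<chi> i. real k)}) = (UNIV :: (real^'n) set)"
    proof safe
      fix x :: "real^'n"
      obtain k :: nat where k: "norm x \<le> real k" using real_arch_simple by blast
      have "x $ i \<le> real k" for i
        using component_le_norm_cart[of x i] k by linarith
      then show "x \<in> (\<Union>k::nat. {..(\<chi> i. real k)})" by (auto simp: less_eq_vec_def)
    qed simp
  qed (auto simp: orthant)
qed

text \<open>The parameter is only some number here; \<open>correlation_gauss_pair\<close> is what
  identifies it with the correlation of the scores.\<close>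

lemma normal_scores_pair:
  fixes X :: "'n::finite \<Rightarrow> 'a \<Rightarrow> real"
  assumes P: "prob_space P" and f: "\<And>i. \<exists>f. distributed P lborel (X i) f"
    and R: "correlation_matrix R" and cop: "has_gauss_copula P X R" and ij: "i \<noteq> j"
  defines "Z \<equiv> \<lambda>i \<omega>. normal_score (distr P borel (X i)) (X i \<omega>)"
  obtains \<rho> where "\<rho>\<^sup>2 < 1"
    "distributed P (lborel \<Otimes>\<^sub>M lborel) (\<lambda>\<omega>. (Z i \<omega>, Z j \<omega>)) (gauss_pair_density \<rho>)"
proof (rule multivariate_normal_pair[OF R ij])
  fix c :: ennreal and \<alpha> \<beta> \<gamma> :: real
  assume c: "c < \<top>" and pos: "\<alpha> > 0" "\<gamma> > 0"
    and law: "\<And>h. h \<in> borel_measurable (lborel \<Otimes>\<^sub>M lborel) \<Longrightarrow> (\<integral>\<^sup>+z. h (z $ i, z $ j) \<partial>multivariate_normal R) =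
      c * (\<integral>\<^sup>+p. h p * ennreal (exp (- (\<alpha> * (fst p)\<^sup>2 + 2 * \<beta> * fst p * snd p + \<gamma> * (snd p)\<^sup>2) / 2))
        \<partial>(lborel \<Otimes>\<^sub>M lborel))"
  interpret P: prob_space P by fact
  have cont: "isCont (cdf (distr P borel (X i))) x" for i x
    using f[of i] isCont_cdf_distributed[OF _ P] by blast
  have X[measurable]: "X i \<in> borel_measurable P" for i
    using f[of i] distributed_measurable by fastforce
  have Z: "distributed P lborel (Z i) std_normal_density" for i
    using f[of i] distributed_normal_score[OF _ P cont] unfolding Z_def by blast
  have [measurable]: "Z i \<in> borel_measurable P" for i
    using distributed_measurable[OF Z[of i]] by simp
  have lawZ: "distr P borel (\<lambda>\<omega>. \<chi> i. Z i \<omega>) = multivariate_normal R"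
    unfolding Z_def
    by (rule normal_scores_multivariate_normal[OF P X cont cop finite_measure_multivariate_normal[OF R ij]])
  have [measurable]: "(\<lambda>\<omega>. \<chi> i. Z i \<omega>) \<in> borel_measurable P"
    by (subst borel_measurable_euclidean_space) (auto simp: Basis_vec_def inner_axis)
  have [measurable]: "(\<lambda>z::real^'n. z $ k) \<in> borel_measurable borel" for k
    by (intro borel_measurable_continuous_onI continuous_intros)
  show thesis
  proof (rule P.gaussian_pair_std_normal[OF Z Z c pos])
    fix h :: "real \<times> real \<Rightarrow> ennreal" assume h[measurable]: "h \<in> borel_measurable (lborel \<Otimes>\<^sub>M lborel)"
    have "(\<integral>\<^sup>+\<omega>. h (Z i \<omega>, Z j \<omega>) \<partial>P) = (\<integral>\<^sup>+z. h (z $ i, z $ j) \<partial>distr P borel (\<lambda>\<omega>. \<chi> i. Z i \<omega>))"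
      by (subst nn_integral_distr) simp_all
    then show "(\<integral>\<^sup>+\<omega>. h (Z i \<omega>, Z j \<omega>) \<partial>P) =
      c * (\<integral>\<^sup>+p. h p * ennreal (exp (- (\<alpha> * (fst p)\<^sup>2 + 2 * \<beta> * fst p * snd p + \<gamma> * (snd p)\<^sup>2) / 2))
        \<partial>(lborel \<Otimes>\<^sub>M lborel))"
      unfolding lawZ law[OF h] .
  qed (rule that)
qed


section \<open>Entropies\<close>

lemma information_space_exp1: "prob_space M \<Longrightarrow> information_space M (exp 1)"
  by (simp add: information_space_def information_space_axioms_def)

lemma log_exp1: "log (exp 1) x = ln x"
  by (simp add: log_def)

section \<open>Integration class by class\<close>

lemma borel_measurable_class_indicator:
  assumes Y: "Y \<in> M \<rightarrow>\<^sub>M count_space Ys" and y: "y \<in> Ys"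
  shows "(indicator {\<omega>. Y \<omega> = y} :: 'a \<Rightarrow> 'b :: {topological_space, zero_neq_one}) \<in> borel_measurable M"
proof -
  have "Y -` {y} \<inter> space M \<in> sets M"
    using y by (intro measurable_sets[OF Y]) simp
  then have "(indicator (Y -` {y} \<inter> space M) :: 'a \<Rightarrow> 'b) \<in> borel_measurable M"
    by (rule borel_measurable_indicator)
  then show ?thesis
    by (rule measurable_cong[THEN iffD1, rotated]) (simp add: indicator_def)
qed

text \<open>The formulas carry the class probability as a factor instead of dividing by it; in this
  form they add up over the classes to an integral over \<open>M\<close>.\<close>

lemma
  assumes "prob_space M" and Y[measurable]: "Y \<in> M \<rightarrow>\<^sub>M count_space Ys" and y: "y \<in> Ys" "class_prob M Y y > 0"
  shows prob_space_given_class: "prob_space (given_class M Y y)"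
    and nn_integral_given_class: "\<And>g. g \<in> borel_measurable M \<Longrightarrow>
      ennreal (class_prob M Y y) * (\<integral>\<^sup>+\<omega>. g \<omega> \<partial>given_class M Y y) = (\<integral>\<^sup>+\<omega>. indicator {\<omega>. Y \<omega> = y} \<omega> * g \<omega> \<partial>M)"
    and integrable_given_class: "\<And>g :: 'a \<Rightarrow> real. g \<in> borel_measurable M \<Longrightarrow>
      integrable (given_class M Y y) g \<longleftrightarrow> integrable M (\<lambda>\<omega>. indicator {\<omega>. Y \<omega> = y} \<omega> * g \<omega>)"
    and integral_given_class: "\<And>g :: 'a \<Rightarrow> real. g \<in> borel_measurable M \<Longrightarrow>
      class_prob M Y y * (\<integral>\<omega>. g \<omega> \<partial>given_class M Y y) = (\<integral>\<omega>. indicator {\<omega>. Y \<omega> = y} \<omega> * g \<omega> \<partial>M)"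
proof -
  interpret prob_space M by fact
  let ?A = "Y -` {y} \<inter> space M"
  let ?c = "class_prob M Y y"
  have A[measurable]: "?A \<in> sets M" using y by measurable
  have c: "emeasure M ?A = ennreal ?c" by (simp add: class_prob_def emeasure_eq_measure)
  show "prob_space (given_class M Y y)"
    unfolding given_class_def using y by (intro prob_space_uniform_measure) (simp_all add: c)
  show "ennreal ?c * (\<integral>\<^sup>+\<omega>. g \<omega> \<partial>given_class M Y y) = (\<integral>\<^sup>+\<omega>. indicator {\<omega>. Y \<omega> = y} \<omega> * g \<omega> \<partial>M)"
    if [measurable]: "g \<in> borel_measurable M" for g
  proof -
    have "(\<integral>\<^sup>+\<omega>. g \<omega> * indicator ?A \<omega> \<partial>M) = (\<integral>\<^sup>+\<omega>. indicator {\<omega>. Y \<omega> = y} \<omega> * g \<omega> \<partial>M)"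
      by (intro nn_integral_cong) (simp add: indicator_def)
    then show ?thesis
      unfolding given_class_def using y
      by (simp add: nn_integral_uniform_measure c ennreal_times_divide ennreal_mult_divide_eq mult.commute[of "ennreal ?c"])
  qed
  have dens: "given_class M Y y = density M (\<lambda>\<omega>. ennreal (indicator ?A \<omega> / ?c))"
  proof -
    have "indicator ?A \<omega> / ennreal ?c = ennreal (indicator ?A \<omega> / ?c)" for \<omega>
      using divide_ennreal[of 1 ?c] y by (simp add: indicator_def)
    then show ?thesis
      unfolding given_class_def uniform_measure_def c by simp
  qed
  have [measurable]: "indicator {\<omega>. Y \<omega> = y} \<in> borel_measurable M"
    by (rule borel_measurable_class_indicator[OF Y y(1)])
  have eq: "indicator ?A \<omega> / ?c * g \<omega> = (1 / ?c) * (indicator {\<omega>. Y \<omega> = y} \<omega> * g \<omega>)" if "\<omega> \<in> space M" for g :: "'a \<Rightarrow> real" and \<omega>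
    using that by (simp add: indicator_def)
  show "integrable (given_class M Y y) g \<longleftrightarrow> integrable M (\<lambda>\<omega>. indicator {\<omega>. Y \<omega> = y} \<omega> * g \<omega>)"
    if [measurable]: "g \<in> borel_measurable M" for g :: "'a \<Rightarrow> real"
  proof -
    have "integrable (given_class M Y y) g \<longleftrightarrow> integrable M (\<lambda>\<omega>. indicator ?A \<omega> / ?c * g \<omega>)"
      unfolding dens using y by (intro integrable_real_density) simp_all
    also have "\<dots> \<longleftrightarrow> integrable M (\<lambda>\<omega>. (1 / ?c) * (indicator {\<omega>. Y \<omega> = y} \<omega> * g \<omega>))"
      by (intro Bochner_Integration.integrable_cong refl eq)
    also have "\<dots> \<longleftrightarrow> integrable M (\<lambda>\<omega>. indicator {\<omega>. Y \<omega> = y} \<omega> * g \<omega>)"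
      using y by (subst integrable_mult_left_iff) simp
    finally show ?thesis .
  qed
  show "?c * (\<integral>\<omega>. g \<omega> \<partial>given_class M Y y) = (\<integral>\<omega>. indicator {\<omega>. Y \<omega> = y} \<omega> * g \<omega> \<partial>M)"
    if [measurable]: "g \<in> borel_measurable M" for g :: "'a \<Rightarrow> real"
  proof -
    have "(\<integral>\<omega>. g \<omega> \<partial>given_class M Y y) = (\<integral>\<omega>. indicator ?A \<omega> / ?c * g \<omega> \<partial>M)"
      unfolding dens using y by (intro integral_real_density) simp_all
    also have "\<dots> = (\<integral>\<omega>. (1 / ?c) * (indicator {\<omega>. Y \<omega> = y} \<omega> * g \<omega>) \<partial>M)"
      by (intro Bochner_Integration.integral_cong refl eq)
    finally show ?thesis using y by simp
  qed
qed

lemma sum_indicator_class: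
  assumes "finite Ys" "Y \<omega> \<in> Ys"
  shows "(\<Sum>y\<in>Ys. indicator {\<omega>. Y \<omega> = y} \<omega> * g y) = (g (Y \<omega>) :: 'b :: semiring_1)"
proof -
  have "(\<Sum>y\<in>Ys. indicator {\<omega>. Y \<omega> = y} \<omega> * g y) = (\<Sum>y\<in>Ys. if Y \<omega> = y then g y else 0)"
    by (intro sum.cong) (auto simp: indicator_def)
  then show ?thesis using assms by simp
qed

lemma class_prob_zero_indicator:
  assumes "prob_space M" and [measurable]: "Y \<in> M \<rightarrow>\<^sub>M count_space Ys" and y: "y \<in> Ys" "class_prob M Y y = 0"
  shows "AE \<omega> in M. Y \<omega> \<noteq> y"
proof -
  interpret prob_space M by fact
  have "Y -` {y} \<inter> space M \<in> null_sets M"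
    using y by (intro null_setsI) (auto simp: class_prob_def emeasure_eq_measure)
  then show ?thesis by (rule AE_I') auto
qed

text \<open>The law of total expectation for an integrand that may depend on the class. A class of
  probability zero has no conditional law; it drops out on the left as a null event and on the right
  through its factor.\<close>

lemma nn_integral_classes:
  assumes M: "prob_space M" and Ys: "finite Ys" and Y: "Y \<in> M \<rightarrow>\<^sub>M count_space Ys"
    and g: "\<And>y. y \<in> Ys \<Longrightarrow> g y \<in> borel_measurable M"
  shows "(\<integral>\<^sup>+\<omega>. g (Y \<omega>) \<omega> \<partial>M) =
    (\<Sum>y\<in>Ys. ennreal (class_prob M Y y) * (\<integral>\<^sup>+\<omega>. g y \<omega> \<partial>given_class M Y y))"
proof -
  note [measurable] = Y
  have ind: "indicator {\<omega>. Y \<omega> = y} \<in> borel_measurable M" if "y \<in> Ys" for y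
    by (rule borel_measurable_class_indicator[OF Y that])
  have 1: "(\<integral>\<^sup>+\<omega>. g (Y \<omega>) \<omega> \<partial>M) = (\<integral>\<^sup>+\<omega>. (\<Sum>y\<in>Ys. indicator {\<omega>. Y \<omega> = y} \<omega> * g y \<omega>) \<partial>M)"
    using measurable_space[OF Y]
    by (intro nn_integral_cong sum_indicator_class[OF Ys, symmetric]) simp
  have 2: "(\<integral>\<^sup>+\<omega>. (\<Sum>y\<in>Ys. indicator {\<omega>. Y \<omega> = y} \<omega> * g y \<omega>) \<partial>M)
      = (\<Sum>y\<in>Ys. \<integral>\<^sup>+\<omega>. indicator {\<omega>. Y \<omega> = y} \<omega> * g y \<omega> \<partial>M)"
    by (rule nn_integral_sum) (rule borel_measurable_times_ennreal[OF ind g])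
  have 3: "(\<Sum>y\<in>Ys. \<integral>\<^sup>+\<omega>. indicator {\<omega>. Y \<omega> = y} \<omega> * g y \<omega> \<partial>M)
      = (\<Sum>y\<in>Ys. ennreal (class_prob M Y y) * (\<integral>\<^sup>+\<omega>. g y \<omega> \<partial>given_class M Y y))"
  proof (rule sum.cong[OF refl])
    fix y assume y: "y \<in> Ys"
    show "(\<integral>\<^sup>+\<omega>. indicator {\<omega>. Y \<omega> = y} \<omega> * g y \<omega> \<partial>M)
      = ennreal (class_prob M Y y) * (\<integral>\<^sup>+\<omega>. g y \<omega> \<partial>given_class M Y y)"
    proof (cases "class_prob M Y y = 0")
      case True
      have "(\<integral>\<^sup>+\<omega>. indicator {\<omega>. Y \<omega> = y} \<omega> * g y \<omega> \<partial>M) = (\<integral>\<^sup>+\<omega>. 0 \<partial>M)"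
        by (rule nn_integral_cong_AE[OF eventually_mono[OF class_prob_zero_indicator[OF M Y y True]]]) simp
      then show ?thesis using True by simp
    next
      case False
      then have "class_prob M Y y > 0" by (simp add: class_prob_def zero_less_measure_iff)
      from nn_integral_given_class[OF M Y y this g[OF y]] show ?thesis ..
    qed
  qed
  show ?thesis by (rule trans[OF 1 trans[OF 2 3]])
qed

lemma integral_classes:
  fixes g :: "'y \<Rightarrow> 'a \<Rightarrow> real"
  assumes M: "prob_space M" and Ys: "finite Ys" and Y: "Y \<in> M \<rightarrow>\<^sub>M count_space Ys"
    and g: "\<And>y. y \<in> Ys \<Longrightarrow> g y \<in> borel_measurable M"
    and int: "\<And>y. y \<in> Ys \<Longrightarrow> class_prob M Y y > 0 \<Longrightarrow> integrable (given_class M Y y) (g y)"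
  shows "(\<integral>\<omega>. g (Y \<omega>) \<omega> \<partial>M) = (\<Sum>y\<in>Ys. class_prob M Y y * (\<integral>\<omega>. g y \<omega> \<partial>given_class M Y y))"
proof -
  note [measurable] = Y
  have ind: "indicator {\<omega>. Y \<omega> = y} \<in> borel_measurable M" if "y \<in> Ys" for y
    by (rule borel_measurable_class_indicator[OF Y that])
  have *: "integrable M (\<lambda>\<omega>. indicator {\<omega>. Y \<omega> = y} \<omega> * g y \<omega>) \<and>
      (\<integral>\<omega>. indicator {\<omega>. Y \<omega> = y} \<omega> * g y \<omega> \<partial>M) = class_prob M Y y * (\<integral>\<omega>. g y \<omega> \<partial>given_class M Y y)"
    if y: "y \<in> Ys" for y
  proof (cases "class_prob M Y y = 0")
    case True
    have ae: "AE \<omega> in M. indicator {\<omega>. Y \<omega> = y} \<omega> * g y \<omega> = 0"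
      using class_prob_zero_indicator[OF M Y y True] by eventually_elim simp
    have m: "(\<lambda>\<omega>. indicator {\<omega>. Y \<omega> = y} \<omega> * g y \<omega>) \<in> borel_measurable M"
      by (intro borel_measurable_times ind g y)
    have "integrable M (\<lambda>\<omega>. indicator {\<omega>. Y \<omega> = y} \<omega> * g y \<omega>)"
      by (subst integrable_cong_AE[OF m _ ae]) simp_all
    moreover have "(\<integral>\<omega>. indicator {\<omega>. Y \<omega> = y} \<omega> * g y \<omega> \<partial>M) = 0"
      by (rule integral_eq_zero_AE[OF ae])
    ultimately show ?thesis using True by simp
  next
    case False
    then have "class_prob M Y y > 0" by (simp add: class_prob_def zero_less_measure_iff)
    with integrable_given_class[OF M Y y this g[OF y]] integral_given_class[OF M Y y this g[OF y]] int[OF y]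
    show ?thesis by simp
  qed
  have 1: "(\<integral>\<omega>. g (Y \<omega>) \<omega> \<partial>M) = (\<integral>\<omega>. (\<Sum>y\<in>Ys. indicator {\<omega>. Y \<omega> = y} \<omega> * g y \<omega>) \<partial>M)"
    using measurable_space[OF Y]
    by (intro Bochner_Integration.integral_cong sum_indicator_class[OF Ys, symmetric] refl) simp
  have 2: "(\<integral>\<omega>. (\<Sum>y\<in>Ys. indicator {\<omega>. Y \<omega> = y} \<omega> * g y \<omega>) \<partial>M)
      = (\<Sum>y\<in>Ys. \<integral>\<omega>. indicator {\<omega>. Y \<omega> = y} \<omega> * g y \<omega> \<partial>M)"
    by (rule Bochner_Integration.integral_sum) (simp add: *)
  have 3: "(\<Sum>y\<in>Ys. \<integral>\<omega>. indicator {\<omega>. Y \<omega> = y} \<omega> * g y \<omega> \<partial>M)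
      = (\<Sum>y\<in>Ys. class_prob M Y y * (\<integral>\<omega>. g y \<omega> \<partial>given_class M Y y))"
    by (intro sum.cong refl) (simp add: *)
  show ?thesis by (rule trans[OF 1 trans[OF 2 3]])
qed

section \<open>Entropy of the class variable and of mixed vectors\<close>

lemma class_entropy:
  assumes M: "prob_space M" and Ys: "finite Ys" and Y: "Y \<in> M \<rightarrow>\<^sub>M count_space Ys"
  shows "diff_entropy M (count_space Ys) Y = - (\<Sum>y\<in>Ys. class_prob M Y y * ln (class_prob M Y y))"
proof -
  interpret information_space M "exp 1" by (rule information_space_exp1[OF M])
  have c0: "0 \<le> class_prob M Y y" for y by (simp add: class_prob_def)
  have "distributed M (count_space Ys) Y (class_prob M Y)"
  proof (rule distributedI_nn_integral[OF Y])
    fix h :: "'b \<Rightarrow> ennreal"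
    have "(\<integral>\<^sup>+\<omega>. h (Y \<omega>) \<partial>M) = (\<Sum>y\<in>Ys. ennreal (class_prob M Y y) * (\<integral>\<^sup>+\<omega>. h y \<partial>given_class M Y y))"
      by (rule nn_integral_classes[OF M Ys Y, of "\<lambda>y \<omega>. h y"]) simp
    also have "\<dots> = (\<Sum>y\<in>Ys. ennreal (class_prob M Y y) * h y)"
    proof (rule sum.cong[OF refl])
      fix y assume y: "y \<in> Ys"
      show "ennreal (class_prob M Y y) * (\<integral>\<^sup>+\<omega>. h y \<partial>given_class M Y y) = ennreal (class_prob M Y y) * h y"
      proof (cases "class_prob M Y y > 0")
        case True
        then show ?thesis
          using prob_space.emeasure_space_1[OF prob_space_given_class[OF M Y y True]] by simp
      qed (use c0[of y] in simp)
    qed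
    finally show "(\<integral>\<^sup>+\<omega>. h (Y \<omega>) \<partial>M) = (\<integral>\<^sup>+y. ennreal (class_prob M Y y) * h y \<partial>count_space Ys)"
      by (simp add: nn_integral_count_space_finite Ys)
  qed simp
  from entropy_distr[OF this c0] show ?thesis
    by (simp add: lebesgue_integral_count_space_finite Ys log_exp1)
qed

text \<open>
  \<open>T\<close> is a copy of the product of \<open>N\<close> with the counting measure on \<open>Ys\<close>, with injections \<open>\<kappa> y\<close> and
  projections \<open>\<pi>\<close> and \<open>\<tau>\<close>; this covers both nestings of the product that occur in the weight.
\<close>

lemma mixed_entropy:
  assumes M: "prob_space M" and Ys: "finite Ys" and Y: "Y \<in> M \<rightarrow>\<^sub>M count_space Ys"
    and X: "X \<in> M \<rightarrow>\<^sub>M N"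
    and \<kappa>: "\<And>y. y \<in> Ys \<Longrightarrow> \<kappa> y \<in> N \<rightarrow>\<^sub>M T" and \<pi>: "\<pi> \<in> T \<rightarrow>\<^sub>M N" and \<tau>: "\<tau> \<in> T \<rightarrow>\<^sub>M count_space Ys"
    and \<kappa>\<pi>: "\<And>y x. \<pi> (\<kappa> y x) = x" and \<kappa>\<tau>: "\<And>y x. \<tau> (\<kappa> y x) = y"
    and V: "(\<lambda>\<omega>. \<kappa> (Y \<omega>) (X \<omega>)) \<in> M \<rightarrow>\<^sub>M T"
    and T: "\<And>\<phi>. \<phi> \<in> borel_measurable T \<Longrightarrow> (\<integral>\<^sup>+t. \<phi> t \<partial>T) = (\<Sum>y\<in>Ys. \<integral>\<^sup>+x. \<phi> (\<kappa> y x) \<partial>N)"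
    and f: "\<And>y. y \<in> Ys \<Longrightarrow> class_prob M Y y > 0 \<Longrightarrow>
      information_space.finite_entropy (given_class M Y y) (exp 1) N X (f y)"
  shows "diff_entropy M T (\<lambda>\<omega>. \<kappa> (Y \<omega>) (X \<omega>)) =
    diff_entropy M (count_space Ys) Y + (\<Sum>y\<in>Ys. class_prob M Y y * diff_entropy (given_class M Y y) N X)"
proof -
  interpret information_space M "exp 1" by (rule information_space_exp1[OF M])
  let ?c = "class_prob M Y"
  have c0: "0 \<le> ?c y" for y by (simp add: class_prob_def)
  \<comment> \<open>The joint density is class probability times conditional density. On null
    classes, where \<open>f y\<close> is unconstrained, it is set to zero.\<close>
  define F where "F y x = (if ?c y > 0 then ?c y * f y x else 0)" for y x
  have info: "information_space (given_class M Y y) (exp 1)" if "y \<in> Ys" "?c y > 0" for y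
    by (rule information_space_exp1[OF prob_space_given_class[OF M Y that]])
  have fe: "distributed (given_class M Y y) N X (f y)" "integrable N (\<lambda>x. f y x * ln (f y x))"
      "\<And>x. x \<in> space N \<Longrightarrow> 0 \<le> f y x" if "y \<in> Ys" "?c y > 0" for y
    using f[OF that] unfolding information_space.finite_entropy_def[OF info[OF that]] by (simp_all add: log_exp1)
  have fm: "f y \<in> borel_measurable N" if "y \<in> Ys" "?c y > 0" for y
    using distributed_real_measurable[OF fe(3)[OF that] fe(1)[OF that]] .
  have Fm: "F y \<in> borel_measurable N" if "y \<in> Ys" for y
    unfolding F_def[abs_def] using fm[OF that] by (cases "?c y > 0") simp_all
  have F0: "0 \<le> F y x" if "y \<in> Ys" "x \<in> space N" for y x
    using fe(3)[OF that(1) _ that(2)] c0[of y] by (simp add: F_def)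
  define p where "p t = F (\<tau> t) (\<pi> t)" for t
  \<comment> \<open>Measurability holds class by class and glues along \<open>\<tau>\<close>, as
    there are only finitely many classes.\<close>
  have p_meas[measurable]: "p \<in> borel_measurable T"
    unfolding p_def[abs_def]
    using Ys by (intro measurable_compose_countable'[OF measurable_compose[OF \<pi> Fm] \<tau>]) (simp_all add: countable_finite)
  have p0: "0 \<le> p t" if "t \<in> space T" for t
    unfolding p_def using measurable_space[OF \<tau> that] measurable_space[OF \<pi> that] by (intro F0) simp_all
  have p\<kappa>: "p (\<kappa> y x) = F y x" for y x by (simp add: p_def \<kappa>\<pi> \<kappa>\<tau>)
  have "distributed M T (\<lambda>\<omega>. \<kappa> (Y \<omega>) (X \<omega>)) p"
  proof (rule distributedI_nn_integral[OF V])
    show "(\<lambda>t. ennreal (p t)) \<in> borel_measurable T" by simp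
    fix h :: "_ \<Rightarrow> ennreal" assume h: "h \<in> borel_measurable T"
    have h\<kappa>: "(\<lambda>x. h (\<kappa> y x)) \<in> borel_measurable N" if "y \<in> Ys" for y
      by (rule measurable_compose[OF \<kappa>[OF that] h])
    have "(\<integral>\<^sup>+\<omega>. h (\<kappa> (Y \<omega>) (X \<omega>)) \<partial>M)
        = (\<Sum>y\<in>Ys. ennreal (?c y) * (\<integral>\<^sup>+\<omega>. h (\<kappa> y (X \<omega>)) \<partial>given_class M Y y))"
      by (rule nn_integral_classes[OF M Ys Y, of "\<lambda>y \<omega>. h (\<kappa> y (X \<omega>))"]) (rule measurable_compose[OF X h\<kappa>])
    also have "\<dots> = (\<Sum>y\<in>Ys. \<integral>\<^sup>+x. ennreal (p (\<kappa> y x)) * h (\<kappa> y x) \<partial>N)"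
    proof (rule sum.cong[OF refl])
      fix y assume y: "y \<in> Ys"
      show "ennreal (?c y) * (\<integral>\<^sup>+\<omega>. h (\<kappa> y (X \<omega>)) \<partial>given_class M Y y)
        = (\<integral>\<^sup>+x. ennreal (p (\<kappa> y x)) * h (\<kappa> y x) \<partial>N)"
      proof (cases "?c y > 0")
        case True
        note [measurable] = fm[OF y True] h\<kappa>[OF y]
        have "ennreal (?c y) * (\<integral>\<^sup>+\<omega>. h (\<kappa> y (X \<omega>)) \<partial>given_class M Y y)
          = ennreal (?c y) * (\<integral>\<^sup>+x. ennreal (f y x) * h (\<kappa> y x) \<partial>N)"
          by (simp only: distributed_nn_integral[OF fe(1)[OF y True] h\<kappa>[OF y]])
        also have "\<dots> = (\<integral>\<^sup>+x. ennreal (?c y) * (ennreal (f y x) * h (\<kappa> y x)) \<partial>N)"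
          by (rule nn_integral_cmult[symmetric]) measurable
        also have "\<dots> = (\<integral>\<^sup>+x. ennreal (p (\<kappa> y x)) * h (\<kappa> y x) \<partial>N)"
          using True by (intro nn_integral_cong) (simp add: p\<kappa> F_def ennreal_mult' mult.assoc)
        finally show ?thesis .
      next
        case False
        then show ?thesis using c0[of y] by (simp add: p\<kappa> F_def)
      qed
    qed
    also have "\<dots> = (\<integral>\<^sup>+t. ennreal (p t) * h t \<partial>T)"
      using h by (intro T[symmetric]) simp
    finally show "(\<integral>\<^sup>+\<omega>. h (\<kappa> (Y \<omega>) (X \<omega>)) \<partial>M) = (\<integral>\<^sup>+t. ennreal (p t) * h t \<partial>T)" .
  qed
  note pd = this
  have cls: "integrable (given_class M Y y) (\<lambda>\<omega>. ln (F y (X \<omega>))) \<and>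
      (\<integral>\<omega>. ln (F y (X \<omega>)) \<partial>given_class M Y y) = ln (?c y) - diff_entropy (given_class M Y y) N X"
    if y: "y \<in> Ys" "?c y > 0" for y
  proof -
    interpret Py: information_space "given_class M Y y" "exp 1" by (rule info[OF y])
    note fy = fe(1)[OF y]
    note [measurable] = fm[OF y] Fm[OF y(1)]
    have int_f: "integrable N (f y)" and f1: "(\<integral>x. f y x \<partial>N) = 1"
      using distributed_integrable[OF fy, of "\<lambda>_. 1"] distributed_integral[OF fy, of "\<lambda>_. 1"] fe(3)[OF y] Py.prob_space
      by simp_all
    \<comment> \<open>Where \<open>f y x = 0\<close> the logarithm of the product does not split,
      but then both sides vanish.\<close>
    have eq: "f y x * ln (F y x) = ln (?c y) * f y x + f y x * ln (f y x)" if "x \<in> space N" for x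
      using fe(3)[OF y that] y by (cases "f y x = 0") (simp_all add: F_def ln_mult algebra_simps)
    have int: "integrable N (\<lambda>x. f y x * ln (F y x))"
      using int_f fe(2)[OF y] by (simp add: eq cong: Bochner_Integration.integrable_cong)
    have "(\<integral>x. f y x * ln (F y x) \<partial>N) = (\<integral>x. ln (?c y) * f y x + f y x * ln (f y x) \<partial>N)"
      by (intro Bochner_Integration.integral_cong refl eq)
    also have "\<dots> = ln (?c y) + (\<integral>x. f y x * ln (f y x) \<partial>N)"
      using int_f fe(2)[OF y] f1 by simp
    also have "\<dots> = ln (?c y) - diff_entropy (given_class M Y y) N X"
      using Py.entropy_distr[OF fy fe(3)[OF y]] by (simp add: log_exp1)
    finally have "(\<integral>x. f y x * ln (F y x) \<partial>N) = ln (?c y) - diff_entropy (given_class M Y y) N X" .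
    with int show ?thesis
      using distributed_integrable[OF fy, of "\<lambda>x. ln (F y x)"] distributed_integral[OF fy, of "\<lambda>x. ln (F y x)"] fe(3)[OF y]
      by simp
  qed
  have "diff_entropy M T (\<lambda>\<omega>. \<kappa> (Y \<omega>) (X \<omega>)) = - (\<integral>t. p t * ln (p t) \<partial>T)"
    using entropy_distr[OF pd p0] by (simp add: log_exp1)
  \<comment> \<open>As an expectation over \<open>M\<close> the entropy integral can be split by
    classes.\<close>
  also have "(\<integral>t. p t * ln (p t) \<partial>T) = (\<integral>\<omega>. ln (p (\<kappa> (Y \<omega>) (X \<omega>))) \<partial>M)"
    by (rule distributed_integral[OF pd _ p0]) simp_all
  also have "\<dots> = (\<integral>\<omega>. ln (F (Y \<omega>) (X \<omega>)) \<partial>M)"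
    by (simp add: p\<kappa>)
  also have "\<dots> = (\<Sum>y\<in>Ys. ?c y * (\<integral>\<omega>. ln (F y (X \<omega>)) \<partial>given_class M Y y))"
    using cls measurable_compose[OF X Fm] by (intro integral_classes[OF M Ys Y]) simp_all
  also have "\<dots> = (\<Sum>y\<in>Ys. ?c y * (ln (?c y) - diff_entropy (given_class M Y y) N X))"
  proof (rule sum.cong[OF refl])
    fix y assume "y \<in> Ys"
    then show "?c y * (\<integral>\<omega>. ln (F y (X \<omega>)) \<partial>given_class M Y y) = ?c y * (ln (?c y) - diff_entropy (given_class M Y y) N X)"
      using cls[of y] c0[of y] by (cases "?c y > 0") simp_all
  qed
  finally show ?thesis
    by (simp add: class_entropy[OF M Ys Y] right_diff_distrib sum_subtractf)
qed

section \<open>The Gaussian copula density and the entropy of a pair of features\<close>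

definition gauss_ratio :: "real \<Rightarrow> real \<Rightarrow> real \<Rightarrow> real" where
  "gauss_ratio \<rho> u w = normal_density (\<rho> * w) (sqrt (1 - \<rho>\<^sup>2)) u / std_normal_density u"

lemma borel_measurable_gauss_ratio[measurable (raw)]:
  assumes [measurable]: "u \<in> borel_measurable M" "w \<in> borel_measurable M"
  shows "(\<lambda>x. gauss_ratio \<rho> (u x) (w x)) \<in> borel_measurable M"
  unfolding gauss_ratio_def normal_density_def by measurable

lemma gauss_ratio_nonneg: "0 \<le> gauss_ratio \<rho> u w"
  by (simp add: gauss_ratio_def)

text \<open>Shows what \<open>gauss_ratio\<close> is: the density of the Gaussian copula expressed
  in the scores, that is, the joint normal density divided by both marginal densities.\<close>

lemma gauss_pair_density_ratio:
  "gauss_pair_density \<rho> (u, w) = std_normal_density w * (std_normal_density u * gauss_ratio \<rho> u w)"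
proof -
  have "std_normal_density u > 0" by (rule normal_density_pos) simp
  then show ?thesis by (simp add: gauss_pair_density_def gauss_ratio_def)
qed

text \<open>The logarithm is a quadratic polynomial in the scores, so its expectation is a matter of
  second moments.\<close>

lemma ln_gauss_ratio:
  assumes "\<rho>\<^sup>2 < 1"
  shows "gauss_ratio \<rho> u w > 0"
    and "ln (gauss_ratio \<rho> u w) = - ln (1 - \<rho>\<^sup>2) / 2 - (u\<^sup>2 - 2 * \<rho> * (u * w) + \<rho>\<^sup>2 * w\<^sup>2) / (2 * (1 - \<rho>\<^sup>2)) + u\<^sup>2 / 2"
proof -
  let ?s = "sqrt (1 - \<rho>\<^sup>2)"
  have s: "?s > 0" "?s\<^sup>2 = 1 - \<rho>\<^sup>2" using assms by simp_all
  show "gauss_ratio \<rho> u w > 0"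
    unfolding gauss_ratio_def using s by (intro divide_pos_pos normal_density_pos) simp_all
  have "gauss_ratio \<rho> u w = exp (- (u - \<rho> * w)\<^sup>2 / (2 * (1 - \<rho>\<^sup>2))) * exp (u\<^sup>2 / 2) / ?s"
  proof -
    have "sqrt (2 * pi * (1 - \<rho>\<^sup>2)) = sqrt (2 * pi) * ?s" by (rule real_sqrt_mult)
    moreover have "sqrt (2 * pi) \<noteq> 0" by simp
    ultimately show ?thesis
      unfolding gauss_ratio_def normal_density_def s(2) by (simp add: exp_minus field_simps)
  qed
  then have "ln (gauss_ratio \<rho> u w) = - (u - \<rho> * w)\<^sup>2 / (2 * (1 - \<rho>\<^sup>2)) + u\<^sup>2 / 2 - ln ?s"
    using s by (simp add: ln_div ln_mult)
  also have "ln ?s = ln (1 - \<rho>\<^sup>2) / 2" using assms by (simp add: ln_sqrt)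
  also have "(u - \<rho> * w)\<^sup>2 = u\<^sup>2 - 2 * \<rho> * (u * w) + \<rho>\<^sup>2 * w\<^sup>2"
    by (simp add: power2_eq_square algebra_simps)
  finally show "ln (gauss_ratio \<rho> u w) = - ln (1 - \<rho>\<^sup>2) / 2 - (u\<^sup>2 - 2 * \<rho> * (u * w) + \<rho>\<^sup>2 * w\<^sup>2) / (2 * (1 - \<rho>\<^sup>2)) + u\<^sup>2 / 2"
    unfolding minus_divide_left[symmetric] by linarith
qed

text \<open>The inverse is needed in two places: along the random variable itself, and under a
  Lebesgue integral, where it is valid at points of positive density.\<close>

lemma AE_normal_score_left_inverse:
  assumes f: "distributed M lborel X f" and M: "prob_space M"
  obtains \<psi> where "\<psi> \<in> borel_measurable borel"
    "AE \<omega> in M. \<psi> (normal_score (distr M borel X) (X \<omega>)) = X \<omega>"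
    "AE x in lborel. 0 < f x \<longrightarrow> \<psi> (normal_score (distr M borel X) x) = x"
proof -
  let ?N = "distr M borel X"
  have X: "X \<in> borel_measurable M" using distributed_measurable[OF f] by simp
  have N: "real_distribution ?N"
    using M X by (rule prob_space.real_distribution_distr)
  obtain \<psi> where \<psi>: "\<psi> \<in> borel_measurable borel" and ae: "AE x in ?N. \<psi> (normal_score ?N x) = x"
    by (rule normal_score_left_inverse[OF N isCont_cdf_distributed[OF f M]])
  have N_eq: "?N = density lborel f"
    using distributed_distr_eq_density[OF f] by (simp cong: distr_cong)
  have "AE x in lborel. 0 < f x \<longrightarrow> \<psi> (normal_score ?N x) = x"
    using ae distributed_borel_measurable[OF f]
    by (subst (asm) (1) N_eq) (simp add: AE_density)
  with \<psi> AE_distrD[OF X ae] show thesis by (intro that)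
qed

text \<open>A test function of the features is written as one of the scores, integrated with the
  known joint density of the scores, and carried back to the features one coordinate at a
  time.\<close>

lemma distributed_pair_of_normal_scores:
  fixes f g :: "real \<Rightarrow> real"
  assumes P: "prob_space P"
    and f: "distributed P lborel X f" "\<And>x. 0 \<le> f x" and g: "distributed P lborel W g" "\<And>x. 0 \<le> g x"
    and law: "distributed P (lborel \<Otimes>\<^sub>M lborel)
      (\<lambda>\<omega>. (normal_score (distr P borel X) (X \<omega>), normal_score (distr P borel W) (W \<omega>))) (gauss_pair_density \<rho>)"
  shows "distributed P (lborel \<Otimes>\<^sub>M lborel) (\<lambda>\<omega>. (X \<omega>, W \<omega>)) (\<lambda>p. f (fst p) * g (snd p) *
    gauss_ratio \<rho> (normal_score (distr P borel X) (fst p)) (normal_score (distr P borel W) (snd p)))"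
proof -
  let ?s = "normal_score (distr P borel X)" and ?t = "normal_score (distr P borel W)"
  have [measurable]: "X \<in> borel_measurable P" "W \<in> borel_measurable P"
    using distributed_measurable[OF f(1)] distributed_measurable[OF g(1)] by simp_all
  have [measurable]: "f \<in> borel_measurable borel" "g \<in> borel_measurable borel"
    using distributed_real_measurable[OF _ f(1)] distributed_real_measurable[OF _ g(1)] f(2) g(2) by simp_all
  have [measurable]: "?s \<in> borel_measurable borel" "?t \<in> borel_measurable borel"
    using P by (simp_all add: borel_measurable_normal_score prob_space.real_distribution_distr)
  note scoreX = nn_integral_normal_score[OF f(1) P isCont_cdf_distributed[OF f(1) P]]
  note scoreW = nn_integral_normal_score[OF g(1) P isCont_cdf_distributed[OF g(1) P]]
  obtain \<psi> where [measurable]: "\<psi> \<in> borel_measurable borel" and \<psi>: "AE \<omega> in P. \<psi> (?s (X \<omega>)) = X \<omega>"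
      "AE x in lborel. 0 < ennreal (f x) \<longrightarrow> \<psi> (?s x) = x"
    by (rule AE_normal_score_left_inverse[OF f(1) P])
  obtain \<theta> where [measurable]: "\<theta> \<in> borel_measurable borel" and \<theta>: "AE \<omega> in P. \<theta> (?t (W \<omega>)) = W \<omega>"
      "AE x in lborel. 0 < ennreal (g x) \<longrightarrow> \<theta> (?t x) = x"
    by (rule AE_normal_score_left_inverse[OF g(1) P])
  show ?thesis
  proof (rule distributedI_nn_integral)
    fix h :: "real \<times> real \<Rightarrow> ennreal" assume "h \<in> borel_measurable (lborel \<Otimes>\<^sub>M lborel)"
    then have [measurable]: "h \<in> borel_measurable (borel \<Otimes>\<^sub>M borel)" by simp
    have "(\<integral>\<^sup>+\<omega>. h (X \<omega>, W \<omega>) \<partial>P) = (\<integral>\<^sup>+\<omega>. h (\<psi> (?s (X \<omega>)), \<theta> (?t (W \<omega>))) \<partial>P)"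
    proof (rule nn_integral_cong_AE)
      show "AE \<omega> in P. h (X \<omega>, W \<omega>) = h (\<psi> (?s (X \<omega>)), \<theta> (?t (W \<omega>)))"
        using \<psi>(1) \<theta>(1) by eventually_elim simp
    qed
    also have "\<dots> = (\<integral>\<^sup>+p. ennreal (gauss_pair_density \<rho> p) * h (\<psi> (fst p), \<theta> (snd p)) \<partial>(lborel \<Otimes>\<^sub>M lborel))"
      by (subst distributed_nn_integral[OF law]) simp_all
    also have "\<dots> = (\<integral>\<^sup>+w. \<integral>\<^sup>+u. ennreal (gauss_pair_density \<rho> (u, w)) * h (\<psi> u, \<theta> w) \<partial>lborel \<partial>lborel)"
      by (subst lborel_pair.nn_integral_snd[symmetric]) simp_all
    also have "\<dots> = (\<integral>\<^sup>+w. ennreal (std_normal_density w) *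
        (\<integral>\<^sup>+u. ennreal (std_normal_density u) * (ennreal (gauss_ratio \<rho> u w) * h (\<psi> u, \<theta> w)) \<partial>lborel) \<partial>lborel)"
      by (subst nn_integral_cmult[symmetric])
        (simp_all add: gauss_pair_density_ratio ennreal_mult' gauss_ratio_nonneg mult.assoc)
    also have "\<dots> = (\<integral>\<^sup>+w. ennreal (std_normal_density w) *
        (\<integral>\<^sup>+x. ennreal (f x) * (ennreal (gauss_ratio \<rho> (?s x) w) * h (\<psi> (?s x), \<theta> w)) \<partial>lborel) \<partial>lborel)"
      by (subst scoreX) simp_all
    also have "\<dots> = (\<integral>\<^sup>+y. ennreal (g y) *
        (\<integral>\<^sup>+x. ennreal (f x) * (ennreal (gauss_ratio \<rho> (?s x) (?t y)) * h (\<psi> (?s x), \<theta> (?t y))) \<partial>lborel) \<partial>lborel)"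
      by (rule scoreW) simp
    \<comment> \<open>The inverses cancel the scores only almost everywhere where the densities are
      positive; elsewhere a factor of the integrand is zero.\<close>
    also have "\<dots> = (\<integral>\<^sup>+y. ennreal (g y) *
        (\<integral>\<^sup>+x. ennreal (f x) * (ennreal (gauss_ratio \<rho> (?s x) (?t y)) * h (x, y)) \<partial>lborel) \<partial>lborel)"
    proof (rule nn_integral_cong_AE)
      show "AE y in lborel. ennreal (g y) *
          (\<integral>\<^sup>+x. ennreal (f x) * (ennreal (gauss_ratio \<rho> (?s x) (?t y)) * h (\<psi> (?s x), \<theta> (?t y))) \<partial>lborel)
        = ennreal (g y) * (\<integral>\<^sup>+x. ennreal (f x) * (ennreal (gauss_ratio \<rho> (?s x) (?t y)) * h (x, y)) \<partial>lborel)"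
        using \<theta>(2)
      proof eventually_elim
        case (elim y)
        show ?case
        proof (cases "0 < ennreal (g y)")
          case True
          have "AE x in lborel. ennreal (f x) * (ennreal (gauss_ratio \<rho> (?s x) (?t y)) * h (\<psi> (?s x), \<theta> (?t y)))
            = ennreal (f x) * (ennreal (gauss_ratio \<rho> (?s x) (?t y)) * h (x, y))"
            using \<psi>(2)
          proof eventually_elim
            case (elim x)
            then show ?case using True \<open>0 < ennreal (g y) \<longrightarrow> \<theta> (?t y) = y\<close>
              by (cases "0 < f x") (simp_all add: ennreal_neg not_less)
          qed
          then show ?thesis by (simp only: nn_integral_cong_AE)
        qed (simp add: ennreal_neg not_less)
      qed
    qed
    also have "\<dots> = (\<integral>\<^sup>+y. \<integral>\<^sup>+x. ennreal (f x * g y * gauss_ratio \<rho> (?s x) (?t y)) * h (x, y) \<partial>lborel \<partial>lborel)"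
      using f(2) g(2)
      by (subst nn_integral_cmult[symmetric]) (simp_all add: ennreal_mult' gauss_ratio_nonneg mult_ac)
    also have "\<dots> = (\<integral>\<^sup>+p. ennreal (f (fst p) * g (snd p) * gauss_ratio \<rho> (?s (fst p)) (?t (snd p))) * h p \<partial>(lborel \<Otimes>\<^sub>M lborel))"
      by (subst lborel_pair.nn_integral_snd[symmetric]) simp_all
    finally show "(\<integral>\<^sup>+\<omega>. h (X \<omega>, W \<omega>) \<partial>P) =
      (\<integral>\<^sup>+p. ennreal (f (fst p) * g (snd p) * gauss_ratio \<rho> (?s (fst p)) (?t (snd p))) * h p \<partial>(lborel \<Otimes>\<^sub>M lborel))" .
  qed simp_all
qed

text \<open>The logarithm of the joint density is a sum of three integrable terms: one for each
  feature and one for the copula. Finiteness of the pair entropy is recorded as well, since the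
  chain rule for mixed vectors requires it.\<close>

lemma pair_entropy:
  fixes f g :: "real \<Rightarrow> real"
  assumes P: "prob_space P"
    and f: "information_space.finite_entropy P (exp 1) lborel X f"
    and g: "information_space.finite_entropy P (exp 1) lborel W g"
    and \<rho>: "\<rho>\<^sup>2 < 1"
    and law: "distributed P (lborel \<Otimes>\<^sub>M lborel)
      (\<lambda>\<omega>. (normal_score (distr P borel X) (X \<omega>), normal_score (distr P borel W) (W \<omega>))) (gauss_pair_density \<rho>)"
  shows "\<exists>h. information_space.finite_entropy P (exp 1) (lborel \<Otimes>\<^sub>M lborel) (\<lambda>\<omega>. (X \<omega>, W \<omega>)) h"
    and "diff_entropy P (lborel \<Otimes>\<^sub>M lborel) (\<lambda>\<omega>. (X \<omega>, W \<omega>)) =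
      diff_entropy P lborel X + diff_entropy P lborel W + ln (1 - \<rho>\<^sup>2) / 2"
proof -
  interpret information_space P "exp 1" by (rule information_space_exp1[OF P])
  let ?s = "normal_score (distr P borel X)" and ?t = "normal_score (distr P borel W)"
  have fd: "distributed P lborel X f" "\<And>x. 0 \<le> f x" "integrable lborel (\<lambda>x. f x * ln (f x))"
    and gd: "distributed P lborel W g" "\<And>x. 0 \<le> g x" "integrable lborel (\<lambda>x. g x * ln (g x))"
    using f g unfolding finite_entropy_def by (simp_all add: log_exp1)
  have [measurable]: "X \<in> borel_measurable P" "W \<in> borel_measurable P"
    using distributed_measurable[OF fd(1)] distributed_measurable[OF gd(1)] by simp_all
  have [measurable]: "f \<in> borel_measurable borel" "g \<in> borel_measurable borel"
    using distributed_real_measurable[OF _ fd(1)] distributed_real_measurable[OF _ gd(1)] fd(2) gd(2) by simp_all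
  have [measurable]: "?s \<in> borel_measurable borel" "?t \<in> borel_measurable borel"
    using P by (simp_all add: borel_measurable_normal_score prob_space.real_distribution_distr)
  define r where "r p = gauss_ratio \<rho> (?s (fst p)) (?t (snd p))" for p
  define h where "h p = f (fst p) * g (snd p) * r p" for p
  have [measurable]: "r \<in> borel_measurable (borel \<Otimes>\<^sub>M borel)" unfolding r_def[abs_def] by measurable
  have [measurable]: "h \<in> borel_measurable (borel \<Otimes>\<^sub>M borel)" unfolding h_def[abs_def] by measurable
  have hd: "distributed P (lborel \<Otimes>\<^sub>M lborel) (\<lambda>\<omega>. (X \<omega>, W \<omega>)) h"
    using distributed_pair_of_normal_scores[OF P fd(1,2) gd(1,2) law] by (simp add: h_def[abs_def] r_def)
  have h0: "0 \<le> h p" for p using fd(2) gd(2) by (simp add: h_def r_def gauss_ratio_nonneg)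
  have U: "distributed P lborel (\<lambda>\<omega>. ?s (X \<omega>)) std_normal_density"
    and W: "distributed P lborel (\<lambda>\<omega>. ?t (W \<omega>)) std_normal_density"
    by (rule distributed_normal_score[OF fd(1) P isCont_cdf_distributed[OF fd(1) P]]
        distributed_normal_score[OF gd(1) P isCont_cdf_distributed[OF gd(1) P]])+
  note mom = std_normal_moments(3,4)[OF U] std_normal_moments(3,4)[OF W] gauss_pair_product_moment[OF U W \<rho> law]
  define L where "L p = ln (f (fst p)) + ln (g (snd p)) + ln (r p)" for p
  have [measurable]: "L \<in> borel_measurable (borel \<Otimes>\<^sub>M borel)" unfolding L_def[abs_def] by measurable
  have eq: "h p * ln (h p) = h p * L p" for p
  proof (cases "h p = 0")
    case False
    then have "f (fst p) > 0" "g (snd p) > 0" "r p > 0"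
      using fd(2)[of "fst p"] gd(2)[of "snd p"] ln_gauss_ratio(1)[OF \<rho>] by (auto simp: h_def r_def)
    then show ?thesis by (simp add: h_def L_def ln_mult)
  qed simp
  have Lf: "integrable P (\<lambda>\<omega>. ln (f (X \<omega>)))" "expectation (\<lambda>\<omega>. ln (f (X \<omega>))) = - diff_entropy P lborel X"
    using distributed_integrable[OF fd(1), of "\<lambda>x. ln (f x)"] distributed_integral[OF fd(1), of "\<lambda>x. ln (f x)"]
      fd(2,3) entropy_distr[OF fd(1)] by (simp_all add: log_exp1)
  have Lg: "integrable P (\<lambda>\<omega>. ln (g (W \<omega>)))" "expectation (\<lambda>\<omega>. ln (g (W \<omega>))) = - diff_entropy P lborel W"
    using distributed_integrable[OF gd(1), of "\<lambda>x. ln (g x)"] distributed_integral[OF gd(1), of "\<lambda>x. ln (g x)"]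
      gd(2,3) entropy_distr[OF gd(1)] by (simp_all add: log_exp1)
  have Lr: "integrable P (\<lambda>\<omega>. ln (r (X \<omega>, W \<omega>)))" "expectation (\<lambda>\<omega>. ln (r (X \<omega>, W \<omega>))) = - ln (1 - \<rho>\<^sup>2) / 2"
  proof -
    show "integrable P (\<lambda>\<omega>. ln (r (X \<omega>, W \<omega>)))"
      unfolding r_def fst_conv snd_conv ln_gauss_ratio(2)[OF \<rho>] using mom by simp
    \<comment> \<open>With unit second moments and product moment \<rho>, the quadratic terms amount
      to -1/2 + 1/2, so only the logarithm survives.\<close>
    have "expectation (\<lambda>\<omega>. ln (r (X \<omega>, W \<omega>)))
        = - ln (1 - \<rho>\<^sup>2) / 2 - (1 - 2 * \<rho> * \<rho> + \<rho>\<^sup>2 * 1) / (2 * (1 - \<rho>\<^sup>2)) + 1 / 2"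
      unfolding r_def fst_conv snd_conv ln_gauss_ratio(2)[OF \<rho>] using mom by (simp add: prob_space)
    also have "1 - 2 * \<rho> * \<rho> + \<rho>\<^sup>2 * 1 = 1 - \<rho>\<^sup>2" by (simp add: power2_eq_square)
    finally show "expectation (\<lambda>\<omega>. ln (r (X \<omega>, W \<omega>))) = - ln (1 - \<rho>\<^sup>2) / 2"
      using \<rho> by simp
  qed
  have int: "integrable P (\<lambda>\<omega>. L (X \<omega>, W \<omega>))"
    using Lf(1) Lg(1) Lr(1) by (simp add: L_def)
  have "integrable (lborel \<Otimes>\<^sub>M lborel) (\<lambda>p. h p * L p)"
    using int by (subst distributed_integrable[OF hd]) (simp_all add: h0)
  then have "finite_entropy (lborel \<Otimes>\<^sub>M lborel) (\<lambda>\<omega>. (X \<omega>, W \<omega>)) h"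
    unfolding finite_entropy_def log_exp1 eq using hd h0 by simp
  then show "\<exists>h. finite_entropy (lborel \<Otimes>\<^sub>M lborel) (\<lambda>\<omega>. (X \<omega>, W \<omega>)) h"
    by (rule exI[of _ h])
  have "diff_entropy P (lborel \<Otimes>\<^sub>M lborel) (\<lambda>\<omega>. (X \<omega>, W \<omega>)) = - (\<integral>p. h p * L p \<partial>(lborel \<Otimes>\<^sub>M lborel))"
    using entropy_distr[OF hd h0] by (simp add: log_exp1 eq)
  also have "(\<integral>p. h p * L p \<partial>(lborel \<Otimes>\<^sub>M lborel)) = expectation (\<lambda>\<omega>. L (X \<omega>, W \<omega>))"
    by (rule distributed_integral[OF hd]) (simp_all add: h0)
  also have "\<dots> = - diff_entropy P lborel X - diff_entropy P lborel W - ln (1 - \<rho>\<^sup>2) / 2"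
    unfolding L_def fst_conv snd_conv using Lf Lg Lr by simp
  finally show "diff_entropy P (lborel \<Otimes>\<^sub>M lborel) (\<lambda>\<omega>. (X \<omega>, W \<omega>)) =
      diff_entropy P lborel X + diff_entropy P lborel W + ln (1 - \<rho>\<^sup>2) / 2"
    by simp
qed

lemma class_pair_entropy:
  fixes X :: "'n::finite \<Rightarrow> 'a \<Rightarrow> real"
  assumes M: "prob_space M" and Y: "Y \<in> M \<rightarrow>\<^sub>M count_space Ys" and y: "y \<in> Ys" "class_prob M Y y > 0"
    and fe: "\<And>i. \<exists>f. information_space.finite_entropy (given_class M Y y) (exp 1) lborel (X i) f"
    and R: "correlation_matrix R" "has_gauss_copula (given_class M Y y) X R" and ij: "i \<noteq> j"
  shows "\<exists>h. information_space.finite_entropy (given_class M Y y) (exp 1) (lborel \<Otimes>\<^sub>M lborel) (\<lambda>\<omega>. (X i \<omega>, X j \<omega>)) h"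
    and "diff_entropy (given_class M Y y) (lborel \<Otimes>\<^sub>M lborel) (\<lambda>\<omega>. (X i \<omega>, X j \<omega>)) =
      diff_entropy (given_class M Y y) lborel (X i) + diff_entropy (given_class M Y y) lborel (X j)
      + ln (1 - (class_corr M X Y y i j)\<^sup>2) / 2"
proof -
  let ?P = "given_class M Y y"
  have P: "prob_space ?P" by (rule prob_space_given_class[OF M Y y])
  interpret information_space ?P "exp 1" by (rule information_space_exp1[OF P])
  have d: "\<exists>f. distributed ?P lborel (X i) f" for i
    using fe[of i] unfolding finite_entropy_def by blast
  let ?Z = "\<lambda>i \<omega>. normal_score (distr ?P borel (X i)) (X i \<omega>)"
  obtain \<rho> where \<rho>: "\<rho>\<^sup>2 < 1" "distributed ?P (lborel \<Otimes>\<^sub>M lborel) (\<lambda>\<omega>. (?Z i \<omega>, ?Z j \<omega>)) (gauss_pair_density \<rho>)"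
    by (rule normal_scores_pair[OF P d R ij])
  have std: "distributed ?P lborel (?Z i) std_normal_density" for i
  proof -
    obtain f where f: "distributed ?P lborel (X i) f" using d by blast
    show ?thesis by (rule distributed_normal_score[OF f P isCont_cdf_distributed[OF f P]])
  qed
  have "transformed M X Y y i = ?Z i" for i
    by (simp add: transformed_def normal_score_def fun_eq_iff)
  then have corr: "class_corr M X Y y i j = \<rho>"
    unfolding class_corr_def using correlation_gauss_pair[OF std std \<rho>] by simp
  obtain f where f: "finite_entropy lborel (X i) f" using fe by blast
  obtain g where g: "finite_entropy lborel (X j) g" using fe by blast
  show "\<exists>h. finite_entropy (lborel \<Otimes>\<^sub>M lborel) (\<lambda>\<omega>. (X i \<omega>, X j \<omega>)) h"
    by (rule pair_entropy(1)[OF P f g \<rho>])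
  show "diff_entropy ?P (lborel \<Otimes>\<^sub>M lborel) (\<lambda>\<omega>. (X i \<omega>, X j \<omega>)) =
      diff_entropy ?P lborel (X i) + diff_entropy ?P lborel (X j) + ln (1 - (class_corr M X Y y i j)\<^sup>2) / 2"
    unfolding corr by (rule pair_entropy(2)[OF P f g \<rho>])
qed

section \<open>Information contents of separators and clusters\<close>

lemma info_class_eq:
  fixes Y :: "'a \<Rightarrow> 'y"
  assumes M: "prob_space M" and Ys: "finite Ys" and Y: "Y \<in> M \<rightarrow>\<^sub>M count_space Ys"
    and X: "X s \<in> borel_measurable M"
    and fe: "\<And>y. y \<in> Ys \<Longrightarrow> class_prob M Y y > 0 \<Longrightarrow>
      \<exists>f. information_space.finite_entropy (given_class M Y y) (exp 1) lborel (X s) f"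
  shows "info_class M X Y Ys s = diff_entropy M lborel (X s)
    - (\<Sum>y\<in>Ys. class_prob M Y y * diff_entropy (given_class M Y y) lborel (X s))"
proof -
  obtain f where f: "\<And>y. y \<in> Ys \<Longrightarrow> class_prob M Y y > 0 \<Longrightarrow>
      information_space.finite_entropy (given_class M Y y) (exp 1) lborel (X s) (f y)"
    using fe by metis
  interpret count: sigma_finite_measure "count_space Ys"
    by (rule sigma_finite_measure_count_space_finite[OF Ys])
  have "diff_entropy M (lborel \<Otimes>\<^sub>M count_space Ys) (\<lambda>\<omega>. (\<lambda>y x. (x, y)) (Y \<omega>) (X s \<omega>)) =
    diff_entropy M (count_space Ys) Y + (\<Sum>y\<in>Ys. class_prob M Y y * diff_entropy (given_class M Y y) lborel (X s))"
  proof (rule mixed_entropy[where \<pi> = fst and \<tau> = snd, OF M Ys Y])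
    note [measurable] = X Y
    show "X s \<in> M \<rightarrow>\<^sub>M lborel" by simp
    show "(\<lambda>\<omega>. (X s \<omega>, Y \<omega>)) \<in> M \<rightarrow>\<^sub>M lborel \<Otimes>\<^sub>M count_space Ys" by measurable
    fix \<phi> :: "real \<times> 'y \<Rightarrow> ennreal" assume \<phi>[measurable]: "\<phi> \<in> borel_measurable (lborel \<Otimes>\<^sub>M count_space Ys)"
    have m: "(\<lambda>x. \<phi> (x, y)) \<in> borel_measurable lborel" if "y \<in> Ys" for y
      by (rule measurable_compose[OF measurable_Pair2' \<phi>]) (use that in simp)
    have "(\<integral>\<^sup>+t. \<phi> t \<partial>(lborel \<Otimes>\<^sub>M count_space Ys)) = (\<integral>\<^sup>+x. \<integral>\<^sup>+y. \<phi> (x, y) \<partial>count_space Ys \<partial>lborel)"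
      by (rule count.nn_integral_fst[OF \<phi>, symmetric])
    also have "\<dots> = (\<integral>\<^sup>+x. (\<Sum>y\<in>Ys. \<phi> (x, y)) \<partial>lborel)"
      by (simp add: nn_integral_count_space_finite Ys)
    also have "\<dots> = (\<Sum>y\<in>Ys. \<integral>\<^sup>+x. \<phi> (x, y) \<partial>lborel)"
      by (rule nn_integral_sum[OF m])
    finally show "(\<integral>\<^sup>+t. \<phi> t \<partial>(lborel \<Otimes>\<^sub>M count_space Ys)) = (\<Sum>y\<in>Ys. \<integral>\<^sup>+x. \<phi> (x, y) \<partial>lborel)" .
  qed (use f in simp_all)
  then show ?thesis by (simp add: info_class_def)
qed

text \<open>The chain rule cancels the entropy of \<open>Y\<close>. The triple product nests to the
  right, so the class is inserted behind the second feature and Fubini is applied repeatedly to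
  regroup the features as a pair.\<close>

lemma info_pair_class_eq:
  fixes Y :: "'a \<Rightarrow> 'y"
  assumes M: "prob_space M" and Ys: "finite Ys" and Y: "Y \<in> M \<rightarrow>\<^sub>M count_space Ys"
    and X: "X i \<in> borel_measurable M" "X j \<in> borel_measurable M"
    and fe: "\<And>y. y \<in> Ys \<Longrightarrow> class_prob M Y y > 0 \<Longrightarrow>
      \<exists>f. information_space.finite_entropy (given_class M Y y) (exp 1) (lborel \<Otimes>\<^sub>M lborel) (\<lambda>\<omega>. (X i \<omega>, X j \<omega>)) f"
  shows "info_pair_class M X Y Ys i j = diff_entropy M lborel (X i) + diff_entropy M lborel (X j)
    - (\<Sum>y\<in>Ys. class_prob M Y y * diff_entropy (given_class M Y y) (lborel \<Otimes>\<^sub>M lborel) (\<lambda>\<omega>. (X i \<omega>, X j \<omega>)))"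
proof -
  obtain f where f: "\<And>y. y \<in> Ys \<Longrightarrow> class_prob M Y y > 0 \<Longrightarrow>
      information_space.finite_entropy (given_class M Y y) (exp 1) (lborel \<Otimes>\<^sub>M lborel) (\<lambda>\<omega>. (X i \<omega>, X j \<omega>)) (f y)"
    using fe by metis
  interpret count: sigma_finite_measure "count_space Ys"
    by (rule sigma_finite_measure_count_space_finite[OF Ys])
  interpret lc: pair_sigma_finite "lborel :: real measure" "count_space Ys" ..
  let ?T = "lborel \<Otimes>\<^sub>M lborel \<Otimes>\<^sub>M count_space Ys :: (real \<times> real \<times> 'y) measure"
  let ?\<kappa> = "\<lambda>y p. (fst p, snd p, y)"
  have "diff_entropy M ?T (\<lambda>\<omega>. ?\<kappa> (Y \<omega>) (X i \<omega>, X j \<omega>)) =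
    diff_entropy M (count_space Ys) Y
    + (\<Sum>y\<in>Ys. class_prob M Y y * diff_entropy (given_class M Y y) (lborel \<Otimes>\<^sub>M lborel) (\<lambda>\<omega>. (X i \<omega>, X j \<omega>)))"
  proof (rule mixed_entropy[where \<pi> = "\<lambda>t. (fst t, fst (snd t))" and \<tau> = "\<lambda>t. snd (snd t)", OF M Ys Y])
    note [measurable] = X Y
    show "(\<lambda>\<omega>. (X i \<omega>, X j \<omega>)) \<in> M \<rightarrow>\<^sub>M lborel \<Otimes>\<^sub>M lborel" by measurable
    show \<kappa>: "?\<kappa> y \<in> lborel \<Otimes>\<^sub>M lborel \<rightarrow>\<^sub>M ?T" if "y \<in> Ys" for y
    proof -
      have [measurable]: "(\<lambda>p. y) \<in> lborel \<Otimes>\<^sub>M lborel \<rightarrow>\<^sub>M count_space Ys"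
        using that by (intro measurable_const) simp
      show ?thesis by measurable
    qed
    show "(\<lambda>t. (fst t, fst (snd t))) \<in> ?T \<rightarrow>\<^sub>M lborel \<Otimes>\<^sub>M lborel" by measurable
    show "(\<lambda>t. snd (snd t)) \<in> ?T \<rightarrow>\<^sub>M count_space Ys" by measurable
    show "(\<lambda>\<omega>. ?\<kappa> (Y \<omega>) (X i \<omega>, X j \<omega>)) \<in> M \<rightarrow>\<^sub>M ?T" by measurable
    fix \<phi> :: "real \<times> real \<times> 'y \<Rightarrow> ennreal" assume \<phi>[measurable]: "\<phi> \<in> borel_measurable ?T"
    have m: "(\<lambda>p. \<phi> (fst p, snd p, y)) \<in> borel_measurable (lborel \<Otimes>\<^sub>M lborel)" if "y \<in> Ys" for y
      by (rule measurable_compose[OF \<kappa>[OF that] \<phi>])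
    have m2: "(\<lambda>x'. \<phi> (x, x', y)) \<in> borel_measurable lborel" if "y \<in> Ys" for x y
      using measurable_compose[OF measurable_Pair1' m[OF that], of x] by simp
    have m1: "(\<lambda>x. \<integral>\<^sup>+x'. \<phi> (x, x', y) \<partial>lborel) \<in> borel_measurable lborel" if "y \<in> Ys" for y
      using lborel.borel_measurable_nn_integral_fst[OF m[OF that]] by simp
    have "(\<integral>\<^sup>+t. \<phi> t \<partial>?T) = (\<integral>\<^sup>+x. \<integral>\<^sup>+q. \<phi> (x, q) \<partial>(lborel \<Otimes>\<^sub>M count_space Ys) \<partial>lborel)"
      by (rule lc.P.nn_integral_fst[OF \<phi>, symmetric])
    also have "\<dots> = (\<integral>\<^sup>+x. \<integral>\<^sup>+x'. (\<Sum>y\<in>Ys. \<phi> (x, x', y)) \<partial>lborel \<partial>lborel)"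
      by (subst count.nn_integral_fst[symmetric]) (simp_all add: nn_integral_count_space_finite Ys)
    also have "\<dots> = (\<Sum>y\<in>Ys. \<integral>\<^sup>+x. \<integral>\<^sup>+x'. \<phi> (x, x', y) \<partial>lborel \<partial>lborel)"
      using m1 m2 by (simp add: nn_integral_sum)
    also have "\<dots> = (\<Sum>y\<in>Ys. \<integral>\<^sup>+p. \<phi> (fst p, snd p, y) \<partial>(lborel \<Otimes>\<^sub>M lborel))"
    proof (rule sum.cong[OF refl])
      fix y assume "y \<in> Ys"
      from lborel.nn_integral_fst[OF m[OF this]]
      show "(\<integral>\<^sup>+x. \<integral>\<^sup>+x'. \<phi> (x, x', y) \<partial>lborel \<partial>lborel) = (\<integral>\<^sup>+p. \<phi> (fst p, snd p, y) \<partial>(lborel \<Otimes>\<^sub>M lborel))"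
        by simp
    qed
    finally show "(\<integral>\<^sup>+t. \<phi> t \<partial>?T) = (\<Sum>y\<in>Ys. \<integral>\<^sup>+p. \<phi> (fst p, snd p, y) \<partial>(lborel \<Otimes>\<^sub>M lborel))" .
  qed (use f in simp_all)
  then show ?thesis by (simp add: info_pair_class_def)
qed

section \<open>Assembling the weight\<close>

theorem theorem14:
  fixes M :: "'a measure"
    and X :: "'n::{finite, linorder} \<Rightarrow> 'a \<Rightarrow> real"
    and Y :: "'a \<Rightarrow> 'y"
    and Ys :: "'y set"
    and C S :: "'n option set set"
    and \<nu> :: "'n option set \<Rightarrow> nat"
  assumes "prob_space M"
    and "finite Ys"
    and "Y \<in> M \<rightarrow>\<^sub>M count_space Ys"
    and continuous: "\<And>i. \<exists>f. distributed M lborel (X i) f"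
    and finite_entropy: "\<And>i y. y \<in> Ys \<Longrightarrow> class_prob M Y y > 0 \<Longrightarrow>
      \<exists>f. information_space.finite_entropy (given_class M Y y) (exp 1) lborel (X i) f"
    and gauss_copula: "\<And>y. y \<in> Ys \<Longrightarrow> class_prob M Y y > 0 \<Longrightarrow>
      \<exists>R. correlation_matrix R \<and> has_gauss_copula (given_class M Y y) X R"
    and junction_tree: "gnb_junction_tree UNIV C S \<nu>"
  shows "gnb_weight M X Y Ys C S \<nu> =
    (\<Sum>i\<in>UNIV. diff_entropy M lborel (X i))
    - (\<Sum>y\<in>Ys. class_prob M Y y * (\<Sum>i\<in>UNIV. diff_entropy (given_class M Y y) lborel (X i)))
    - (1/2) * (\<Sum>(i, j)\<in>cluster_pairs C. \<Sum>y\<in>Ys.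
        class_prob M Y y * ln (1 - (class_corr M X Y y i j)\<^sup>2))"
proof -
  note M = assms(1) and Ys = assms(2) and Y = assms(3)
  let ?c = "class_prob M Y"
  have X: "X i \<in> borel_measurable M" for i
    using continuous[of i] distributed_measurable by fastforce
  \<comment> \<open>\<open>G i\<close> is the mutual information of feature \<open>i\<close> and the
    class: the separator term, and the single term per feature that survives the
    telescoping.\<close>
  define G where "G i = diff_entropy M lborel (X i) - (\<Sum>y\<in>Ys. ?c y * diff_entropy (given_class M Y y) lborel (X i))" for i
  define D where "D i j = (\<Sum>y\<in>Ys. ?c y * ln (1 - (class_corr M X Y y i j)\<^sup>2))" for i j
  have single: "info_class M X Y Ys s = G s" for s
    unfolding G_def by (rule info_class_eq[OF M Ys Y X finite_entropy])
  have pair: "info_pair_class M X Y Ys i j = G i + G j - 1/2 * D i j" if ij: "i \<noteq> j" for i j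
  proof -
    have h: "\<exists>h. information_space.finite_entropy (given_class M Y y) (exp 1) (lborel \<Otimes>\<^sub>M lborel) (\<lambda>\<omega>. (X i \<omega>, X j \<omega>)) h"
      and H: "diff_entropy (given_class M Y y) (lborel \<Otimes>\<^sub>M lborel) (\<lambda>\<omega>. (X i \<omega>, X j \<omega>)) =
        diff_entropy (given_class M Y y) lborel (X i) + diff_entropy (given_class M Y y) lborel (X j)
        + ln (1 - (class_corr M X Y y i j)\<^sup>2) / 2"
      if y: "y \<in> Ys" "?c y > 0" for y
    proof -
      obtain R where R: "correlation_matrix R" "has_gauss_copula (given_class M Y y) X R"
        using gauss_copula[OF y] by blast
      show "\<exists>h. information_space.finite_entropy (given_class M Y y) (exp 1) (lborel \<Otimes>\<^sub>M lborel) (\<lambda>\<omega>. (X i \<omega>, X j \<omega>)) h"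
        by (rule class_pair_entropy(1)[OF M Y y finite_entropy[OF y] R ij])
      show "diff_entropy (given_class M Y y) (lborel \<Otimes>\<^sub>M lborel) (\<lambda>\<omega>. (X i \<omega>, X j \<omega>)) =
        diff_entropy (given_class M Y y) lborel (X i) + diff_entropy (given_class M Y y) lborel (X j)
        + ln (1 - (class_corr M X Y y i j)\<^sup>2) / 2"
        by (rule class_pair_entropy(2)[OF M Y y finite_entropy[OF y] R ij])
    qed
    have "(\<Sum>y\<in>Ys. ?c y * diff_entropy (given_class M Y y) (lborel \<Otimes>\<^sub>M lborel) (\<lambda>\<omega>. (X i \<omega>, X j \<omega>)))
      = (\<Sum>y\<in>Ys. ?c y * (diff_entropy (given_class M Y y) lborel (X i) + diff_entropy (given_class M Y y) lborel (X j)
        + ln (1 - (class_corr M X Y y i j)\<^sup>2) / 2))"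
    proof (rule sum.cong[OF refl])
      fix y assume y: "y \<in> Ys"
      \<comment> \<open>For null classes nothing is known about the conditional entropies, but both
        sides carry the factor zero.\<close>
      have "?c y = 0 \<or> ?c y > 0" by (auto simp: class_prob_def zero_less_measure_iff)
      then show "?c y * diff_entropy (given_class M Y y) (lborel \<Otimes>\<^sub>M lborel) (\<lambda>\<omega>. (X i \<omega>, X j \<omega>))
        = ?c y * (diff_entropy (given_class M Y y) lborel (X i) + diff_entropy (given_class M Y y) lborel (X j)
        + ln (1 - (class_corr M X Y y i j)\<^sup>2) / 2)"
        using H[OF y] by auto
    qed
    then show ?thesis
      using info_pair_class_eq[OF M Ys Y X X h]
      by (simp add: G_def D_def ring_distribs sum.distrib sum_divide_distrib)
  qed
  \<comment> \<open>Listed clusters have i < j, so their two features are distinct and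
    \<open>pair\<close> applies.\<close>
  have "(\<Sum>(i, j)\<in>cluster_pairs C. info_pair_class M X Y Ys i j)
    = (\<Sum>(i, j)\<in>cluster_pairs C. G i + G j) - 1/2 * (\<Sum>(i, j)\<in>cluster_pairs C. D i j)"
    unfolding sum_distrib_left sum_subtractf[symmetric]
    by (intro sum.cong) (auto simp: cluster_pairs_def pair)
  then have "gnb_weight M X Y Ys C S \<nu> = (\<Sum>i\<in>UNIV. G i) - 1/2 * (\<Sum>(i, j)\<in>cluster_pairs C. D i j)"
    using gnb_junction_tree_sum[OF junction_tree, of G] by (simp add: gnb_weight_def single)
  also have "(\<Sum>i\<in>UNIV. G i) = (\<Sum>i\<in>UNIV. diff_entropy M lborel (X i))
    - (\<Sum>y\<in>Ys. ?c y * (\<Sum>i\<in>UNIV. diff_entropy (given_class M Y y) lborel (X i)))"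
    unfolding G_def sum_subtractf sum_distrib_left by (simp only: sum.swap[of _ Ys])
  finally show ?thesis unfolding D_def .
qed

end
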